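(* Let $x_0\in L^2(\Omega,\mathcal F,\mathbb P;H)$ and let $(x_n)_{n\in\mathbb N}$ be generated as follows. For every $n\in\mathbb N$, set $\mathcal X_n=\sigma(x_0,\dots,x_n)$ and take $t_n^*\in L^2(\Omega,\mathcal F,\mathbb P;H)$, $\eta_n\in L^1(\Omega,\mathcal F,\mathbb P;\mathbb R)$, and $\varepsilon_n\in\mathfrak C(\Omega,\mathcal F,\mathbb P;H)$ such that $$\frac{1_{[t_n^*\ne0]}1_{[\langle x_n,t_n^*\rangle>\eta_n]}\,\eta_n}{\|t_n^*\|+1_{[t_n^*=0]}}\in L^2(\Omega,\mathcal F,\mathbb P;\mathbb R)$$ and, with $$\alpha_n=\frac{1_{[t_n^*\ne0]}1_{[\langle x_n,t_n^*\rangle>\eta_n]}\big(\langle x_n,t_n^*\rangle-\eta_n\big)}{\|t_n^*\|^2+1_{[t_n^*=0]}},$$ $$(\forall\mathsf z\in Z)\quad\langle\mathsf z,\mathsf E(\alpha_nt_n^*|\mathcal X_n)\rangle\le\mathsf E(\alpha_n\eta_n|\mathcal X_n)+\varepsilon_n(\cdot,\mathsf z)\ \text{ a.s.}$$ Set $d_n=\alpha_nt_n^*$, take $\lambda_n\in L^\infty(\Omega,\mathcal X_n,\mathbb P;\,]0,2[)$, and set $x_{n+1}=x_n-\lambda_nd_n$. Suppose that, for every $\mathsf z\in Z$, $\sum_{n\in\mathbb N}\lambda_n\varepsilon_n(\cdot,\mathsf z)<+\infty$ a.s. and that $\mathfrak W(x_n)_{n\in\mathbb N}\subset Z$ a.s.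 Then $(x_n)_{n\in\mathbb N}$ converges weakly a.s. to a $Z$-valued random variable $x$. If, in addition, for every $\mathsf z\in Z$, $\sum_{n\in\mathbb N}\mathsf E(\lambda_n\varepsilon_n(\cdot,\mathsf z))<+\infty$, then $x\in L^2(\Omega,\mathcal F,\mathbb P;H)$ and $(x_n)_{n\in\mathbb N}$ converges weakly in $L^2(\Omega,\mathcal F,\mathbb P;H)$ to $x$.
   Context: $H$ is a separable real Hilbert space with scalar product $\langle\cdot,\cdot\rangle$, norm $\|\cdot\|$ and Borel $\sigma$-algebra $\mathcal B_H$; $(\Omega,\mathcal F,\mathbb P)$ is a complete probability space with expectation $\mathsf E$; "a.s." means $\mathbb P$-almost surely. $Z$ is a nonempty closed subset of $H$. For an event described by a condition, $1_{[\cdot]}$ denotes its indicator function. For a sub $\sigma$-algebra $\mathcal X$ of $\mathcal F$ and $p\in[1,+\infty[$, $L^p(\Omega,\mathcal X,\mathbb P;H)$ is the space of (classes of a.s. equal) $\mathcal X$-measurable $x\colon\Omega\to H$ with $\mathsf E\|x\|^p<+\infty$; $L^2$ has scalar product $(x,y)\mapsto\mathsf E\langle x,y\rangle$ (similarly with $\mathbb R$ in place of $H$). For $S\subset\mathbb R$, $L^\infty(\Omega,\mathcal X,\mathbb P;S)$ is the set of essentially bounded $\mathcal X$-measurable real random variables with values in $S$ a.s. $\mathsf E(\cdot|\mathcal X)$ is conditional expectation and $\sigma(\cdot)$ the generated $\sigma$-algebra. $\mathfrak C(\Omega,\mathcal F,\mathbb P;H)$ is the class of functions $\varphi\colon\Omega\times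 H\to[0,+\infty[$ such that $\varphi(\omega,\cdot)$ is continuous for $\mathbb P$-almost every $\omega$, $\varphi(\cdot,\mathsf x)$ is $\mathcal F$-measurable for every $\mathsf x\in H$, and $\int_\Omega\varphi(\omega,x(\omega))\,\mathbb P(d\omega)<+\infty$ for every $x\in L^2(\Omega,\mathcal F,\mathbb P;H)$. $\mathfrak W(\mathsf x_n)_{n}$ is the set of weak sequential cluster points of a sequence $(\mathsf x_n)$ in $H$; "$\mathfrak W(x_n)_{n}\subset Z$ a.s." means that $\mathfrak W(x_n(\omega))_n\subset Z$ for $\mathbb P$-almost every $\omega$. Weak convergence a.s. means weak convergence in $H$ of $(x_n(\omega))_n$ for $\mathbb P$-almost every $\omega$. *)

theory Defs
  imports "HOL-Probability.Probability"
begin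

text \<open>Random variables are represented by functions rather than by classes modulo null sets.\<close>

definition Lp_rv :: "'a measure \<Rightarrow> real \<Rightarrow> ('a \<Rightarrow> 'b::real_normed_vector) set" where
  "Lp_rv M p = {f \<in> borel_measurable M. integrable M (\<lambda>\<omega>. norm (f \<omega>) powr p)}"

definition Linf_rv :: "'a measure \<Rightarrow> 'a measure \<Rightarrow> real set \<Rightarrow> ('a \<Rightarrow> real) set" where
  "Linf_rv M \<X> S =
     {f \<in> borel_measurable \<X>. (\<exists>C. AE \<omega> in M. \<bar>f \<omega>\<bar> \<le> C) \<and> (AE \<omega> in M. f \<omega> \<in> S)}"

definition sigma_rvs :: "'a measure \<Rightarrow> (nat \<Rightarrow> 'a \<Rightarrow> 'b::topological_space) \<Rightarrow> nat \<Rightarrow> 'a measure" where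
  "sigma_rvs M x n = sigma (space M) (\<Union>i\<le>n. {x i -` A \<inter> space M | A. A \<in> sets borel})"

text \<open>The library's conditional expectation is restricted to real-valued functions; for
  vector-valued ones we use the usual characterization by averages over the events of \<open>\<X>\<close>.\<close>

definition is_cond_exp ::
  "'a measure \<Rightarrow> 'a measure \<Rightarrow> ('a \<Rightarrow> 'h::{banach, second_countable_topology}) \<Rightarrow> ('a \<Rightarrow> 'h) \<Rightarrow> bool" where
  "is_cond_exp M \<X> f g \<longleftrightarrow>
     g \<in> borel_measurable \<X> \<and> integrable M g \<and>
     (\<forall>A\<in>sets \<X>. (LINT \<omega>:A|M. g \<omega>) = (LINT \<omega>:A|M. f \<omega>))"

definition vec_cond_exp ::
  "'a measure \<Rightarrow> 'a measure \<Rightarrow> ('a \<Rightarrow> 'h::{banach, second_countable_topology}) \<Rightarrow> 'a \<Rightarrow> 'h" where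
  "vec_cond_exp M \<X> f = (SOME g. is_cond_exp M \<X> f g)"

text \<open>In a separable Hilbert space the conditional expectation of an integrable function exists
  and is unique up to null sets, so the choice above is justified.\<close>

context prob_space
begin

lemma sigma_finite_subalgebra_of_prob: "subalgebra M F \<Longrightarrow> sigma_finite_subalgebra M F"
proof -
  assume F: "subalgebra M F"
  interpret finite_measure_subalgebra M F by unfold_locales (rule F)
  show ?thesis by unfold_locales
qed

lemma is_cond_exp_inner:
  fixes f g :: "'a \<Rightarrow> 'h::{real_inner, banach, second_countable_topology}"
  assumes F: "subalgebra M F" and f: "integrable M f" and g: "is_cond_exp M F f g"
  shows "AE \<omega> in M. real_cond_exp M F (\<lambda>\<omega>. inner (f \<omega>) z) \<omega> = inner (g \<omega>) z"
proof -
  interpret sigma_finite_subalgebra M F by (rule sigma_finite_subalgebra_of_prob[OF F])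
  have gi: "integrable M g" and gm[measurable]: "g \<in> borel_measurable F"
    and eq: "\<And>A. A \<in> sets F \<Longrightarrow> (LINT \<omega>:A|M. g \<omega>) = (LINT \<omega>:A|M. f \<omega>)"
    using g by (auto simp: is_cond_exp_def)
  show ?thesis
  proof (rule real_cond_exp_charact)
    fix A assume A: "A \<in> sets F"
    then have AM: "A \<in> sets M" using F by (auto simp: subalgebra_def)
    have *: "(LINT \<omega>:A|M. inner (h \<omega>) z) = inner (LINT \<omega>:A|M. h \<omega>) z" if "integrable M h" for h :: "'a \<Rightarrow> 'h"
      using integral_inner_left[OF integrable_mult_indicator[OF AM that], of z]
      by (simp add: set_lebesgue_integral_def)
    show "(LINT \<omega>:A|M. inner (f \<omega>) z) = (LINT \<omega>:A|M. inner (g \<omega>) z)"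
      using *[OF f] *[OF gi] eq[OF A] by simp
  qed (use f gi in auto)
qed

lemma is_cond_exp_norm:
  fixes f g :: "'a \<Rightarrow> 'h::{real_inner, banach, second_countable_topology}"
  assumes F: "subalgebra M F" and f: "integrable M f" and g: "is_cond_exp M F f g"
  shows "(LINT \<omega>|M. norm (g \<omega>)) \<le> (LINT \<omega>|M. norm (f \<omega>))"
proof -
  interpret sigma_finite_subalgebra M F by (rule sigma_finite_subalgebra_of_prob[OF F])
  obtain D :: "'h set" where D: "countable D" "\<And>U. open U \<Longrightarrow> U \<noteq> {} \<Longrightarrow> \<exists>d\<in>D. d \<in> U"
    using countable_dense_setE by blast
  have gi: "integrable M g" using g by (auto simp: is_cond_exp_def)
  let ?c = "real_cond_exp M F (\<lambda>\<omega>. norm (f \<omega>))"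
  have 1: "AE \<omega> in M. inner (g \<omega>) z \<le> norm z * ?c \<omega>" for z
  proof -
    have "AE \<omega> in M. real_cond_exp M F (\<lambda>\<omega>. inner (f \<omega>) z) \<omega> \<le> real_cond_exp M F (\<lambda>\<omega>. norm z * norm (f \<omega>)) \<omega>"
      by (rule real_cond_exp_mono) (use f norm_cauchy_schwarz[of _ z] in \<open>auto simp: mult.commute[of "norm z"]\<close>)
    moreover have "AE \<omega> in M. real_cond_exp M F (\<lambda>\<omega>. norm z * norm (f \<omega>)) \<omega> = norm z * ?c \<omega>"
      using f by (intro real_cond_exp_cmult) auto
    ultimately show ?thesis using is_cond_exp_inner[OF F f g, of z] by eventually_elim auto
  qed
  have "AE \<omega> in M. \<forall>z\<in>D. inner (g \<omega>) z \<le> norm z * ?c \<omega>"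
    using 1 D(1) by (simp add: AE_ball_countable)
  then have 2: "AE \<omega> in M. norm (g \<omega>) \<le> ?c \<omega>"
  proof eventually_elim
    fix \<omega> assume *: "\<forall>z\<in>D. inner (g \<omega>) z \<le> norm z * ?c \<omega>"
    let ?U = "{z. inner (g \<omega>) z > norm z * ?c \<omega>}"
    have "open ?U" by (intro open_Collect_less continuous_intros)
    then have "?U = {}" using D(2)[of ?U] * by force
    then have "inner (g \<omega>) (g \<omega>) \<le> norm (g \<omega>) * ?c \<omega>" "inner (g \<omega>) 0 \<le> norm (0::'h) * ?c \<omega>"
      by (auto simp: not_less[symmetric])
    then have a: "norm (g \<omega>) * norm (g \<omega>) \<le> norm (g \<omega>) * ?c \<omega>"
      by (simp add: dot_square_norm power2_eq_square)
    show "norm (g \<omega>) \<le> ?c \<omega>"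
    proof (cases "g \<omega> = 0")
      case False then show ?thesis using a by simp
    next
      case True
      show ?thesis
      proof (cases "\<exists>z::'h. z \<noteq> 0")
        case True
        then obtain z :: 'h where z: "z \<noteq> 0" by auto
        have "z \<notin> ?U" using \<open>?U = {}\<close> by auto
        then show ?thesis using \<open>g \<omega> = 0\<close> z by (simp add: not_less zero_le_mult_iff)
      next
        case False
        then have "f = (\<lambda>_. 0)" by auto
        then show ?thesis using \<open>g \<omega> = 0\<close> by (simp add: real_cond_exp_def)
      qed
    qed
  qed
  have "(LINT \<omega>|M. norm (g \<omega>)) \<le> (LINT \<omega>|M. ?c \<omega>)"
    using 2 gi f real_cond_exp_int(1)[of "\<lambda>\<omega>. norm (f \<omega>)"] by (intro integral_mono_AE) auto
  also have "\<dots> = (LINT \<omega>|M. norm (f \<omega>))"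
    using f by (intro real_cond_exp_int(2)) auto
  finally show ?thesis .
qed

lemma is_cond_exp_add:
  assumes F: "subalgebra M F" and "integrable M f" "is_cond_exp M F f g" "integrable M f'" "is_cond_exp M F f' g'"
  shows "is_cond_exp M F (\<lambda>\<omega>. f \<omega> + f' \<omega>) (\<lambda>\<omega>. g \<omega> + g' \<omega>)"
proof -
  have s: "set_integrable M A h" if "A \<in> sets F" "integrable M h" for A and h :: "'a \<Rightarrow> 'b"
    using that F unfolding set_integrable_def subalgebra_def by (intro integrable_mult_indicator) auto
  show ?thesis using assms s by (auto simp: is_cond_exp_def set_integral_add)
qed

lemma is_cond_exp_diff:
  assumes F: "subalgebra M F" and "integrable M f" "is_cond_exp M F f g" "integrable M f'" "is_cond_exp M F f' g'"
  shows "is_cond_exp M F (\<lambda>\<omega>. f \<omega> - f' \<omega>) (\<lambda>\<omega>. g \<omega> - g' \<omega>)"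
proof -
  have s: "set_integrable M A h" if "A \<in> sets F" "integrable M h" for A and h :: "'a \<Rightarrow> 'b"
    using that F unfolding set_integrable_def subalgebra_def by (intro integrable_mult_indicator) auto
  show ?thesis using assms s by (auto simp: is_cond_exp_def set_integral_diff)
qed

lemma ex_is_cond_exp:
  fixes f :: "'a \<Rightarrow> 'h::{real_inner, banach, second_countable_topology}"
  assumes F: "subalgebra M F" and f: "integrable M f"
  shows "\<exists>g. is_cond_exp M F f g"
  using f
proof (induct rule: integrable_induct)
  case (base A c)
  interpret sigma_finite_subalgebra M F by (rule sigma_finite_subalgebra_of_prob[OF F])
  have i: "integrable M (indicator A :: 'a \<Rightarrow> real)" using base by (auto simp: integrable_indicator_iff)
  let ?p = "real_cond_exp M F (indicator A)"
  have pi: "integrable M ?p" using i by (rule real_cond_exp_int)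
  have "is_cond_exp M F (\<lambda>\<omega>. indicator A \<omega> *\<^sub>R c) (\<lambda>\<omega>. ?p \<omega> *\<^sub>R c)"
    unfolding is_cond_exp_def
  proof (intro conjI ballI)
    fix B assume B: "B \<in> sets F"
    then have BM: "B \<in> sets M" using F by (auto simp: subalgebra_def)
    have *: "(LINT \<omega>:B|M. h \<omega> *\<^sub>R c) = (LINT \<omega>:B|M. h \<omega>) *\<^sub>R c" if "integrable M h" for h :: "'a \<Rightarrow> real"
      using integral_scaleR_left[of c M "\<lambda>\<omega>. indicator B \<omega> *\<^sub>R h \<omega>"] integrable_mult_indicator[OF BM that]
      by (simp add: set_lebesgue_integral_def)
    show "(LINT \<omega>:B|M. ?p \<omega> *\<^sub>R c) = (LINT \<omega>:B|M. indicator A \<omega> *\<^sub>R c)"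
      unfolding *[OF pi] *[OF i] real_cond_exp_intA[OF i B] ..
  qed (use pi in auto)
  then show ?case by blast
next
  case (add f g) then show ?case using is_cond_exp_add[OF F] by blast
next
  case (lim f s)
  from lim(2) have "\<forall>i. \<exists>g. is_cond_exp M F (s i) g" by simp
  then have "\<exists>G. \<forall>i. is_cond_exp M F (s i) (G i)" by (rule choice)
  then obtain G where G: "\<And>i. is_cond_exp M F (s i) (G i)" by blast
  have Gi: "integrable M (G i)" "G i \<in> borel_measurable F" for i using G by (auto simp: is_cond_exp_def)
  have "(\<lambda>i. LINT \<omega>|M. norm (s i \<omega> - f \<omega>)) \<longlonglongrightarrow> (LINT \<omega>|M. norm (0::'h))"
  proof (rule integral_dominated_convergence)
    show "AE \<omega> in M. (\<lambda>i. norm (s i \<omega> - f \<omega>)) \<longlonglongrightarrow> norm (0::'h)"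
      using lim(3) by (intro AE_I2 tendsto_norm) (simp add: LIM_zero)
    show "AE \<omega> in M. norm (norm (s i \<omega> - f \<omega>)) \<le> 3 * norm (f \<omega>)" for i
    proof (rule AE_I2)
      fix \<omega> assume "\<omega> \<in> space M"
      then show "norm (norm (s i \<omega> - f \<omega>)) \<le> 3 * norm (f \<omega>)"
        using lim(4)[of \<omega> i] norm_triangle_ineq4[of "s i \<omega>" "f \<omega>"] by simp
    qed
  qed (use lim in auto)
  then have "\<exists>i. (LINT \<omega>|M. norm (s i \<omega> - f \<omega>)) < (1/2)^k" for k :: nat
    using order_tendstoD(2)[of _ 0 sequentially "(1/2::real)^k"] by (fastforce simp: eventually_sequentially)
  then obtain r where r: "\<And>k::nat. (LINT \<omega>|M. norm (s (r k) \<omega> - f \<omega>)) < (1/2)^k" by metis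
  define u where "u k \<omega> = G (r (Suc k)) \<omega> - G (r k) \<omega>" for k \<omega>
  have ui: "integrable M (u k)" "u k \<in> borel_measurable F" for k using Gi unfolding u_def[abs_def] by auto
  have ub: "(LINT \<omega>|M. norm (u k \<omega>)) \<le> 2 * (1/2)^k" for k
  proof -
    have "(LINT \<omega>|M. norm (u k \<omega>)) \<le> (LINT \<omega>|M. norm (s (r (Suc k)) \<omega> - s (r k) \<omega>))"
      unfolding u_def using is_cond_exp_diff[OF F lim(1) G lim(1) G] lim(1)
      by (intro is_cond_exp_norm[OF F]) auto
    also have "\<dots> \<le> (LINT \<omega>|M. norm (s (r (Suc k)) \<omega> - f \<omega>) + norm (s (r k) \<omega> - f \<omega>))"
    proof (intro integral_mono)
      fix \<omega> show "norm (s (r (Suc k)) \<omega> - s (r k) \<omega>) \<le> norm (s (r (Suc k)) \<omega> - f \<omega>) + norm (s (r k) \<omega> - f \<omega>)"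
        using norm_triangle_ineq4[of "s (r (Suc k)) \<omega> - f \<omega>" "s (r k) \<omega> - f \<omega>"] by simp
    qed (use lim in auto)
    also have "\<dots> = (LINT \<omega>|M. norm (s (r (Suc k)) \<omega> - f \<omega>)) + (LINT \<omega>|M. norm (s (r k) \<omega> - f \<omega>))"
      using lim by (intro Bochner_Integration.integral_add) auto
    also have "\<dots> \<le> (1/2)^(Suc k) + (1/2)^k" using r[of k] r[of "Suc k"] by linarith
    also have "\<dots> \<le> 2 * (1/2)^k" by simp
    finally show ?thesis .
  qed
  have su: "summable (\<lambda>k. LINT \<omega>|M. norm (u k \<omega>))"
    by (rule summable_comparison_test'[where g="\<lambda>k. 2 * (1/2)^k"]) (use ub in auto)
  have ae: "AE \<omega> in M. summable (\<lambda>k. norm (u k \<omega>))"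
  proof -
    have "(\<integral>\<^sup>+\<omega>. (\<Sum>k. ennreal (norm (u k \<omega>))) \<partial>M) = (\<Sum>k. \<integral>\<^sup>+\<omega>. ennreal (norm (u k \<omega>)) \<partial>M)"
      using ui by (intro nn_integral_suminf) auto
    also have "\<dots> = (\<Sum>k. ennreal (LINT \<omega>|M. norm (u k \<omega>)))"
      using ui by (intro suminf_cong nn_integral_eq_integral) auto
    also have "\<dots> \<noteq> \<infinity>" using su by (simp add: ennreal_suminf_neq_top)
    finally have fin: "(\<integral>\<^sup>+\<omega>. (\<Sum>k. ennreal (norm (u k \<omega>))) \<partial>M) \<noteq> \<infinity>" .
    have uM[measurable]: "u k \<in> borel_measurable M" for k using ui(1) by (rule borel_measurable_integrable)
    have "(\<lambda>\<omega>. \<Sum>k. ennreal (norm (u k \<omega>))) \<in> borel_measurable M" by measurable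
    from nn_integral_noteq_infinite[OF this fin]
    show ?thesis by (rule AE_mp) (intro AE_I2 impI summable_suminf_not_top, auto)
  qed
  define g where "g \<omega> = G (r 0) \<omega> + (\<Sum>k. u k \<omega>)" for \<omega>
  have si: "integrable M (\<lambda>\<omega>. \<Sum>k. u k \<omega>)" by (rule integrable_suminf[OF ui(1) ae su])
  have "is_cond_exp M F f g" unfolding is_cond_exp_def
  proof (intro conjI ballI)
    have [measurable]: "G i \<in> borel_measurable F" "u k \<in> borel_measurable F" for i k using Gi ui by auto
    show "g \<in> borel_measurable F" unfolding g_def[abs_def] by measurable
    show "integrable M g" unfolding g_def[abs_def] using Gi si by auto
    fix A assume A: "A \<in> sets F"
    then have AM[measurable]: "A \<in> sets M" using F by (auto simp: subalgebra_def)
    have ind: "set_integrable M A h" if "integrable M h" for h :: "'a \<Rightarrow> 'h"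
      using that AM unfolding set_integrable_def by (intro integrable_mult_indicator) auto
    have GA: "(LINT \<omega>:A|M. G i \<omega>) = (LINT \<omega>:A|M. s i \<omega>)" for i using G A by (auto simp: is_cond_exp_def)
    have 1: "(\<lambda>k. LINT \<omega>:A|M. u k \<omega>) sums (LINT \<omega>|M. (\<Sum>k. indicator A \<omega> *\<^sub>R u k \<omega>))"
      unfolding set_lebesgue_integral_def
    proof (rule sums_integral)
      show "integrable M (\<lambda>\<omega>. indicator A \<omega> *\<^sub>R u k \<omega>)" for k using ind[OF ui(1)] by (simp add: set_integrable_def)
      then have i: "integrable M (\<lambda>\<omega>. norm (indicator A \<omega> *\<^sub>R u k \<omega>))" for k by (rule integrable_norm)
      show "AE \<omega> in M. summable (\<lambda>k. norm (indicator A \<omega> *\<^sub>R u k \<omega>))"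
        using ae by eventually_elim (auto simp: indicator_def)
      show "summable (\<lambda>k. LINT \<omega>|M. norm (indicator A \<omega> *\<^sub>R u k \<omega>))"
      proof (rule summable_comparison_test'[OF su])
        fix k
        have "(LINT \<omega>|M. norm (indicator A \<omega> *\<^sub>R u k \<omega>)) \<le> (LINT \<omega>|M. norm (u k \<omega>))"
          using i ui by (intro integral_mono) (auto simp: indicator_def)
        then show "norm (LINT \<omega>|M. norm (indicator A \<omega> *\<^sub>R u k \<omega>)) \<le> (LINT \<omega>|M. norm (u k \<omega>))" by simp
      qed
    qed
    have 2: "(LINT \<omega>|M. (\<Sum>k. indicator A \<omega> *\<^sub>R u k \<omega>)) = (LINT \<omega>:A|M. (\<Sum>k. u k \<omega>))"
      unfolding set_lebesgue_integral_def
      by (intro Bochner_Integration.integral_cong) (auto simp: indicator_def)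
    have 3: "(LINT \<omega>:A|M. u k \<omega>) = (LINT \<omega>:A|M. s (r (Suc k)) \<omega>) - (LINT \<omega>:A|M. s (r k) \<omega>)" for k
      unfolding u_def GA[symmetric] using ind Gi by (intro set_integral_diff) auto
    have 4: "(\<Sum>k<n. (LINT \<omega>:A|M. u k \<omega>)) = (LINT \<omega>:A|M. s (r n) \<omega>) - (LINT \<omega>:A|M. s (r 0) \<omega>)" for n
      unfolding 3 by (rule sum_lessThan_telescope)
    have 5: "(\<lambda>n. LINT \<omega>:A|M. s (r n) \<omega>) \<longlonglongrightarrow> (LINT \<omega>:A|M. f \<omega>)"
    proof (rule LIM_zero_cancel, rule Lim_null_comparison)
      show "\<forall>\<^sub>F n in sequentially. norm ((LINT \<omega>:A|M. s (r n) \<omega>) - (LINT \<omega>:A|M. f \<omega>)) \<le> (1/2)^n"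
      proof (intro always_eventually allI)
        fix n
        have "norm ((LINT \<omega>:A|M. s (r n) \<omega>) - (LINT \<omega>:A|M. f \<omega>)) = norm (LINT \<omega>:A|M. s (r n) \<omega> - f \<omega>)"
          using ind lim by (subst set_integral_diff) auto
        also have "\<dots> \<le> (LINT \<omega>|M. norm (indicator A \<omega> *\<^sub>R (s (r n) \<omega> - f \<omega>)))"
          unfolding set_lebesgue_integral_def by (rule integral_norm_bound)
        also have "\<dots> \<le> (LINT \<omega>|M. norm (s (r n) \<omega> - f \<omega>))"
          using lim ind[of "\<lambda>\<omega>. s (r n) \<omega> - f \<omega>"]
          by (intro integral_mono integrable_norm) (auto simp: indicator_def set_integrable_def)
        finally show "norm ((LINT \<omega>:A|M. s (r n) \<omega>) - (LINT \<omega>:A|M. f \<omega>)) \<le> (1/2)^n" using r[of n] by linarith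
      qed
      show "(\<lambda>n. (1/2)^n) \<longlonglongrightarrow> (0::real)" by (rule LIMSEQ_power_zero) simp
    qed
    have "(\<lambda>n. (LINT \<omega>:A|M. s (r n) \<omega>) - (LINT \<omega>:A|M. s (r 0) \<omega>)) \<longlonglongrightarrow> (LINT \<omega>:A|M. (\<Sum>k. u k \<omega>))"
      using 1 unfolding sums_def 4 2 .
    then have "(LINT \<omega>:A|M. (\<Sum>k. u k \<omega>)) = (LINT \<omega>:A|M. f \<omega>) - (LINT \<omega>:A|M. s (r 0) \<omega>)"
      using tendsto_diff[OF 5 tendsto_const] LIMSEQ_unique by blast
    then show "(LINT \<omega>:A|M. g \<omega>) = (LINT \<omega>:A|M. f \<omega>)"
      unfolding g_def using ind Gi si GA by (subst set_integral_add) auto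
  qed
  then show ?case by blast
qed

lemma is_cond_exp_vec_cond_exp:
  fixes f :: "'a \<Rightarrow> 'h::{real_inner, banach, second_countable_topology}"
  assumes "subalgebra M F" and "integrable M f"
  shows "is_cond_exp M F f (vec_cond_exp M F f)"
  unfolding vec_cond_exp_def using ex_is_cond_exp[OF assms] by (rule someI_ex)

lemma is_cond_exp_unique:
  fixes f :: "'a \<Rightarrow> 'h::{real_inner, banach, second_countable_topology}"
  assumes F: "subalgebra M F" and f: "integrable M f"
    and g: "is_cond_exp M F f g" and h: "is_cond_exp M F f h"
  shows "AE \<omega> in M. g \<omega> = h \<omega>"
proof -
  have gh: "integrable M (\<lambda>\<omega>. norm (g \<omega> - h \<omega>))"
    using g h by (auto simp: is_cond_exp_def)
  have "(LINT \<omega>|M. norm (g \<omega> - h \<omega>)) \<le> (LINT \<omega>|M. norm (f \<omega> - f \<omega>))"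
    using is_cond_exp_diff[OF F f g f h] f by (intro is_cond_exp_norm[OF F]) auto
  moreover have "0 \<le> (LINT \<omega>|M. norm (g \<omega> - h \<omega>))" by simp
  ultimately have "(LINT \<omega>|M. norm (g \<omega> - h \<omega>)) = 0" by simp
  then show ?thesis using integral_nonneg_eq_0_iff_AE[OF gh] by simp
qed

end

definition caratheodory_class :: "'a measure \<Rightarrow> ('a \<Rightarrow> 'h::real_normed_vector \<Rightarrow> real) set" where
  "caratheodory_class M = {\<phi>.
     (\<forall>\<omega>\<in>space M. \<forall>z. 0 \<le> \<phi> \<omega> z) \<and>
     (AE \<omega> in M. continuous_on UNIV (\<phi> \<omega>)) \<and>
     (\<forall>z. (\<lambda>\<omega>. \<phi> \<omega> z) \<in> borel_measurable M) \<and>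
     (\<forall>x\<in>Lp_rv M 2. (\<integral>\<^sup>+\<omega>. ennreal (\<phi> \<omega> (x \<omega>)) \<partial>M) < \<infinity>)}"

text \<open>Weak convergence is expressed through the scalar product, that is, via the Riesz
  representation of continuous linear functionals; in \<open>L\<^sup>2\<close> the scalar product of \<open>u\<close> and \<open>y\<close>
  is the expectation of the pointwise one.\<close>

definition weakly_tendsto :: "(nat \<Rightarrow> 'h::real_inner) \<Rightarrow> 'h \<Rightarrow> bool" where
  "weakly_tendsto u l \<longleftrightarrow> (\<forall>y. (\<lambda>n. inner (u n) y) \<longlonglongrightarrow> inner l y)"

definition weak_cluster_points :: "(nat \<Rightarrow> 'h::real_inner) \<Rightarrow> 'h set" where
  "weak_cluster_points u = {l. \<exists>r. strict_mono r \<and> weakly_tendsto (u \<circ> r) l}"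

definition weakly_tendsto_L2 ::
  "'a measure \<Rightarrow> (nat \<Rightarrow> 'a \<Rightarrow> 'h::{real_inner, banach, second_countable_topology}) \<Rightarrow> ('a \<Rightarrow> 'h) \<Rightarrow> bool" where
  "weakly_tendsto_L2 M u l \<longleftrightarrow>
     (\<forall>n. u n \<in> Lp_rv M 2) \<and> l \<in> Lp_rv M 2 \<and>
     (\<forall>y\<in>Lp_rv M 2. (\<lambda>n. LINT \<omega>|M. inner (u n \<omega>) (y \<omega>)) \<longlonglongrightarrow> (LINT \<omega>|M. inner (l \<omega>) (y \<omega>)))"

end

theory Submission
  imports Defs
begin

text \<open>
  Fix \<open>z \<in> Z\<close>. Up to cutoff and relaxation, \<open>x (n+1)\<close> arises from \<open>x n\<close> by a projection onto the half-space
  \<open>{u. \<langle>u, t n\<rangle> \<le> \<eta> n}\<close>, and \<open>z\<close> satisfies its inequality, weighted by \<open>\<alpha> n\<close>,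
  on conditional average up to the error \<open>\<epsilon> n\<close>.
  Therefore the squared distance to \<open>z\<close> decreases on conditional average, up to a drift:
  \<open>E(\<parallel>x (n+1) - z\<parallel>\<^sup>2 | \<X> n) \<le> \<parallel>x n - z\<parallel>\<^sup>2 + b n\<close>, where \<open>b n\<close> is \<open>2 lam n\<close> times the positive part of
  \<open>\<langle>z, E(d n | \<X> n)\<rangle> - E(\<alpha> n \<eta> n | \<X> n)\<close> (\<open>relaxed_step_expectation\<close>). This drift is at most
  \<open>2 lam n \<epsilon> n\<close>, so it is summable almost surely, and unlike \<open>\<epsilon> n\<close> it is \<open>\<X> n\<close>-measurable.

  A nonnegative process with such a summable drift converges almost surely
  (\<open>quasi_supermartingale.AE_convergent\<close>): if the drift has finite total expectation, Doob's upcrossing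
  argument applies, and the general case follows by freezing the process before the accumulated
  drift becomes large. So \<open>\<parallel>x n - z\<parallel>\<close> converges almost surely for each \<open>z\<close> in a countable dense
  subset of \<open>Z\<close>, hence almost surely for all \<open>z \<in> Z\<close> at once. Since all weak cluster points lie in
  \<open>Z\<close>, Opial's argument (\<open>opial_weak_convergence\<close>) gives weak convergence of almost every trajectory;
  the limit is weakly measurable, hence measurable (\<open>borel_measurable_weakly\<close>).

  If the expected errors are summable, the same drift inequality bounds the second moments of the
  iterates uniformly. Fatou's lemma then puts the limit in \<open>L\<^sup>2\<close>, and a bounded sequence in \<open>L\<^sup>2\<close> whose
  trajectories converge weakly almost surely converges weakly in \<open>L\<^sup>2\<close> (\<open>weakly_tendsto_L2I\<close>).\<close>

section \<open>Weak convergence in separable Hilbert spaces\<close>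

text \<open>The representing vector is the minimizer of \<open>Q y = \<parallel>y\<parallel>\<^sup>2 - 2 L y\<close>: minimizing sequences are Cauchy
  by the parallelogram identity, and the first-order condition at the minimizer is
  \<open>L y = \<langle>l, y\<rangle>\<close>.\<close>

lemma riesz_representation:
  fixes L :: "'h::{real_inner, banach} \<Rightarrow> real"
  assumes "bounded_linear L"
  shows "\<exists>l. \<forall>y. L y = inner l y"
proof -
  interpret L: bounded_linear L by fact
  define Q where "Q y = (norm y)\<^sup>2 - 2 * L y" for y
  obtain K where K: "\<And>y. norm (L y) \<le> norm y * K"
    using L.bounded by blast
  have below: "- K\<^sup>2 \<le> Q y" for y
  proof -
    have "L y \<le> norm y * K" using K[of y] by simp
    moreover have "0 \<le> (norm y - K)\<^sup>2" by simp
    ultimately show ?thesis by (simp add: Q_def power2_diff)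
  qed
  define m where "m = Inf (range Q)"
  have m_le: "m \<le> Q y" for y
    unfolding m_def using below by (intro cInf_lower bdd_belowI[of _ "- K\<^sup>2"]) auto
  have "\<exists>y. Q y < m + inverse (real (Suc n))" for n
    using cInf_lessD[of "range Q" "m + inverse (real (Suc n))"] by (auto simp: m_def)
  then obtain u where u: "\<And>n. Q (u n) < m + inverse (real (Suc n))" by metis
  \<comment> \<open>By the parallelogram identity, two almost-minimizers of \<open>Q\<close> are close to each other.\<close>
  have gap: "(norm (a - b))\<^sup>2 \<le> 2 * (Q a - m) + 2 * (Q b - m)" for a b
  proof -
    have "Q a + Q b = 2 * Q ((1/2) *\<^sub>R (a + b)) + (norm (a - b))\<^sup>2 / 2"
      by (simp add: Q_def L.add L.scaleR power2_norm_eq_inner inner_simps inner_commute field_simps)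
    then show ?thesis using m_le[of "(1/2) *\<^sub>R (a + b)"] by simp
  qed
  have "Cauchy u"
  proof (rule metric_CauchyI)
    fix e :: real assume e: "0 < e"
    then have "0 < e\<^sup>2 / 4" by simp
    then obtain N where N: "inverse (real (Suc N)) < e\<^sup>2 / 4"
      using reals_Archimedean by blast
    have near: "Q (u i) - m < e\<^sup>2 / 4" if "i \<ge> N" for i
    proof -
      have "inverse (real (Suc i)) \<le> inverse (real (Suc N))"
        using that by (intro le_imp_inverse_le) auto
      then show ?thesis using u[of i] N by linarith
    qed
    have "dist (u i) (u j) < e" if "i \<ge> N" "j \<ge> N" for i j
    proof -
      have "(norm (u i - u j))\<^sup>2 < e\<^sup>2"
        using gap[of "u i" "u j"] near[OF that(1)] near[OF that(2)] by simp
      then show ?thesis using e by (simp add: dist_norm power2_less_imp_less)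
    qed
    then show "\<exists>N. \<forall>i\<ge>N. \<forall>j\<ge>N. dist (u i) (u j) < e" by blast
  qed
  then obtain l where l: "u \<longlonglongrightarrow> l" using Cauchy_convergent_iff convergent_def by blast
  have "(\<lambda>n. Q (u n)) \<longlonglongrightarrow> Q l"
    unfolding Q_def by (intro tendsto_intros l L.tendsto)
  moreover have "(\<lambda>n. m + inverse (real (Suc n))) \<longlonglongrightarrow> m + 0"
    by (intro tendsto_intros LIMSEQ_inverse_real_of_nat)
  ultimately have "Q l \<le> m"
    using u by (intro LIMSEQ_le[of "\<lambda>n. Q (u n)" _ "\<lambda>n. m + inverse (real (Suc n))"]) (auto intro: less_imp_le)
  have "L y = inner l y" for y
  proof -
    define c where "c = inner l y - L y"
    have var: "0 \<le> 2 * s * c + s\<^sup>2 * (norm y)\<^sup>2" for s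
    proof -
      have "Q (l + s *\<^sub>R y) = Q l + 2 * s * c + s\<^sup>2 * (norm y)\<^sup>2"
        unfolding Q_def c_def L.add L.scaleR power2_norm_eq_inner
        by (simp add: inner_simps inner_commute power2_eq_square algebra_simps)
      then show ?thesis using m_le[of "l + s *\<^sub>R y"] \<open>Q l \<le> m\<close> by linarith
    qed
    have "c = 0"
    proof (cases "y = 0")
      case False
      then have y: "(norm y)\<^sup>2 > 0" by simp
      \<comment> \<open>The step \<open>s = - c / \<parallel>y\<parallel>\<^sup>2\<close> minimizes the quadratic in \<open>var\<close>; its minimal value must be nonnegative.\<close>
      have "2 * (- c / (norm y)\<^sup>2) * c + (- c / (norm y)\<^sup>2)\<^sup>2 * (norm y)\<^sup>2 = - (c\<^sup>2 / (norm y)\<^sup>2)"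
        using y by (simp add: power2_eq_square field_simps)
      then have "c\<^sup>2 / (norm y)\<^sup>2 \<le> 0" using var[of "- c / (norm y)\<^sup>2"] by linarith
      then show ?thesis using y by (simp add: divide_le_0_iff)
    qed (simp add: c_def L.zero)
    then show ?thesis by (simp add: c_def)
  qed
  then show ?thesis by blast
qed

lemma convergent_inner_of_dense:
  fixes u :: "nat \<Rightarrow> 'h::real_inner"
  assumes B: "\<And>n. norm (u n) \<le> B" and D: "closure D = UNIV"
    and conv: "\<And>d. d \<in> D \<Longrightarrow> convergent (\<lambda>n. inner (u n) d)"
  shows "convergent (\<lambda>n. inner (u n) y)"
proof -
  have "Cauchy (\<lambda>n. inner (u n) y)"
  proof (rule metric_CauchyI)
    fix e :: real assume e: "0 < e"
    have B0: "0 \<le> B" using B[of 0] norm_ge_zero order_trans by blast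
    have "y \<in> closure D" using D by simp
    \<comment> \<open>The summand 1 keeps the denominator positive when \<open>B = 0\<close>.\<close>
    moreover have "0 < e / (3 * (B + 1))" using e B0 by simp
    ultimately obtain d where d: "d \<in> D" "dist d y < e / (3 * (B + 1))"
      unfolding closure_approachable by blast
    have close: "\<bar>inner (u i) y - inner (u i) d\<bar> < e / 3" for i
    proof -
      have "\<bar>inner (u i) (y - d)\<bar> \<le> norm (u i) * norm (y - d)" by (rule Cauchy_Schwarz_ineq2)
      also have "\<dots> \<le> (B + 1) * norm (y - d)" using B[of i] by (intro mult_right_mono) auto
      also have "\<dots> < (B + 1) * (e / (3 * (B + 1)))"
        using d B0 by (intro mult_strict_left_mono) (auto simp: dist_norm norm_minus_commute)
      also have "\<dots> = e / 3" using B0 by (simp add: field_simps)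
      finally show ?thesis by (simp add: inner_diff_right)
    qed
    have "Cauchy (\<lambda>n. inner (u n) d)" using conv[OF d(1)] by (simp add: Cauchy_convergent_iff)
    then obtain N where N: "\<And>i j. i \<ge> N \<Longrightarrow> j \<ge> N \<Longrightarrow> dist (inner (u i) d) (inner (u j) d) < e / 3"
      using metric_CauchyD[of _ "e / 3"] e by (metis divide_pos_pos zero_less_numeral)
    have "dist (inner (u i) y) (inner (u j) y) < e" if "i \<ge> N" "j \<ge> N" for i j
      using close[of i] close[of j] N[OF that] unfolding dist_real_def by linarith
    then show "\<exists>N. \<forall>i\<ge>N. \<forall>j\<ge>N. dist (inner (u i) y) (inner (u j) y) < e" by blast
  qed
  then show ?thesis by (simp add: Cauchy_convergent_iff)
qed

text \<open>Weak sequential compactness of bounded sets. A diagonal argument makes the scalar products with a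
  countable dense set converge along a subsequence, boundedness extends this to all vectors, and the limit is a bounded
  linear functional, hence represented by a vector.\<close>

lemma bounded_imp_weakly_convergent_subsequence:
  fixes u :: "nat \<Rightarrow> 'h::{real_inner, banach, second_countable_topology}"
  assumes B: "\<And>n. norm (u n) \<le> B"
  shows "\<exists>l r. strict_mono r \<and> weakly_tendsto (u \<circ> r) l"
proof -
  obtain D :: "'h set" where D: "countable D" "\<And>U. open U \<Longrightarrow> U \<noteq> {} \<Longrightarrow> \<exists>d\<in>D. d \<in> U"
    using countable_dense_setE by blast
  have dense: "closure D = UNIV"
  proof -
    have "\<exists>d\<in>D. dist d y < e" if "e > 0" for e and y :: 'h
      using D(2)[of "ball y e"] that by (auto simp: dist_commute)
    then show ?thesis by (auto simp: closure_approachable)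
  qed
  interpret subseqs "\<lambda>k s. convergent (\<lambda>n. inner (u (s n)) (from_nat_into D k))"
  proof
    fix k and s :: "nat \<Rightarrow> nat"
    let ?d = "from_nat_into D k"
    have "\<bar>inner (u (s n)) ?d\<bar> \<le> B * norm ?d" for n
      using Cauchy_Schwarz_ineq2[of "u (s n)" ?d] B[of "s n"] mult_right_mono[OF B[of "s n"], of "norm ?d"]
      by simp
    then have "bounded (range (\<lambda>n. inner (u (s n)) ?d))"
      by (intro boundedI[of _ "B * norm ?d"]) auto
    then obtain l r where "strict_mono r" "((\<lambda>n. inner (u (s n)) ?d) \<circ> r) \<longlonglongrightarrow> l"
      using bounded_imp_convergent_subsequence by blast
    then show "\<exists>r. strict_mono r \<and> convergent (\<lambda>n. inner (u ((s \<circ> r) n)) ?d)"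
      by (auto simp: convergent_def o_def)
  qed
  define r where "r = diagseq"
  have r: "strict_mono r" unfolding r_def by (rule subseq_diagseq)
  have convD: "convergent (\<lambda>n. inner (u (r n)) d)" if "d \<in> D" for d
  proof -
    obtain k where k: "d = from_nat_into D k" using \<open>d \<in> D\<close> D(1) by (metis from_nat_into_to_nat_on)
    have "convergent (\<lambda>n. inner (u ((diagseq \<circ> (+) (Suc k)) n)) (from_nat_into D k))"
      by (rule diagseq_holds) (auto simp: o_def intro: convergent_subseq_convergent[unfolded o_def])
    then have "convergent (\<lambda>n. inner (u (r (n + Suc k))) d)" by (simp add: r_def k o_def add.commute)
    then show ?thesis by (rule convergent_ignore_initial_segment[THEN iffD1])
  qed
  have conv: "convergent (\<lambda>n. inner (u (r n)) y)" for y
    by (rule convergent_inner_of_dense[OF B dense convD])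
  define L where "L y = lim (\<lambda>n. inner (u (r n)) y)" for y
  have L: "(\<lambda>n. inner (u (r n)) y) \<longlonglongrightarrow> L y" for y
    using conv[of y] by (simp add: convergent_LIMSEQ_iff L_def)
  have "bounded_linear L"
  proof
    show "L (a + b) = L a + L b" for a b
      using tendsto_add[OF L[of a] L[of b]] L[of "a + b"] LIMSEQ_unique by (auto simp: inner_add_right)
    show "L (c *\<^sub>R a) = c *\<^sub>R L a" for c a
      using tendsto_mult_left[OF L[of a], of c] L[of "c *\<^sub>R a"] LIMSEQ_unique by (auto simp: )
    have "norm (L a) \<le> norm a * B" for a
    proof (rule LIMSEQ_le_const2)
      show "(\<lambda>n. norm (inner (u (r n)) a)) \<longlonglongrightarrow> norm (L a)" by (intro tendsto_norm L)
      show "\<exists>N. \<forall>n\<ge>N. norm (inner (u (r n)) a) \<le> norm a * B"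
        using Cauchy_Schwarz_ineq2[of "u (r _)" a] mult_right_mono[OF B, of "norm a" "r _"]
        by (metis mult.commute norm_ge_zero order_trans real_norm_def)
    qed
    then show "\<exists>K. \<forall>a. norm (L a) \<le> norm a * K" by blast
  qed
  then obtain l where "\<forall>y. L y = inner l y" using riesz_representation by blast
  then have "weakly_tendsto (u \<circ> r) l" using L by (auto simp: weakly_tendsto_def)
  then show ?thesis using r by blast
qed

text \<open>Opial's argument. If \<open>l\<close> and \<open>l'\<close> are weak cluster points, then
  \<open>2 \<langle>u n, l - l'\<rangle> = \<parallel>u n - l'\<parallel>\<^sup>2 - \<parallel>u n - l\<parallel>\<^sup>2 + \<parallel>l\<parallel>\<^sup>2 - \<parallel>l'\<parallel>\<^sup>2\<close> converges, and evaluating its limit along the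
  two subsequences gives \<open>\<langle>l, l - l'\<rangle> = \<langle>l', l - l'\<rangle>\<close>. A bounded sequence with a single weak cluster
  point converges weakly.\<close>

lemma opial_weak_convergence:
  fixes u :: "nat \<Rightarrow> 'h::{real_inner, banach, second_countable_topology}"
  assumes "Z \<noteq> {}" and conv: "\<And>z. z \<in> Z \<Longrightarrow> convergent (\<lambda>n. (norm (u n - z))\<^sup>2)"
    and cluster: "weak_cluster_points u \<subseteq> Z"
  shows "\<exists>l\<in>Z. weakly_tendsto u l"
proof -
  obtain z where z: "z \<in> Z" using \<open>Z \<noteq> {}\<close> by blast
  obtain K where K: "\<And>n. norm ((norm (u n - z))\<^sup>2) \<le> K"
    using convergent_imp_Bseq[OF conv[OF z]] by (auto simp: Bseq_def)
  have bd: "norm (u n) \<le> sqrt K + norm z" for n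
  proof -
    have "norm (u n - z) \<le> sqrt K" using K[of n] by (simp add: real_le_rsqrt)
    then show ?thesis using norm_triangle_sub[of "u n" z] by simp
  qed
  have unique: "l = l'"
    if l: "l \<in> weak_cluster_points u" and l': "l' \<in> weak_cluster_points u" for l l'
  proof -
    obtain r where r: "strict_mono r" "weakly_tendsto (u \<circ> r) l"
      using l by (auto simp: weak_cluster_points_def)
    obtain r' where r': "strict_mono r'" "weakly_tendsto (u \<circ> r') l'"
      using l' by (auto simp: weak_cluster_points_def)
    have "inner (u n) (l - l')
        = ((norm (u n - l'))\<^sup>2 - (norm (u n - l))\<^sup>2 + (norm l)\<^sup>2 - (norm l')\<^sup>2) / 2" for n
      by (simp add: power2_norm_eq_inner inner_simps inner_commute)
    moreover have "convergent (\<lambda>n. ((norm (u n - l'))\<^sup>2 - (norm (u n - l))\<^sup>2 + (norm l)\<^sup>2 - (norm l')\<^sup>2) / 2)"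
      using conv l l' cluster unfolding divide_inverse
      by (intro convergent_mult convergent_diff convergent_add convergent_const) auto
    ultimately obtain c where c: "(\<lambda>n. inner (u n) (l - l')) \<longlonglongrightarrow> c" by (auto simp: convergent_def)
    have "c = inner l (l - l')"
      using LIMSEQ_subseq_LIMSEQ[OF c r(1)] r(2) LIMSEQ_unique unfolding weakly_tendsto_def o_def by blast
    moreover have "c = inner l' (l - l')"
      using LIMSEQ_subseq_LIMSEQ[OF c r'(1)] r'(2) LIMSEQ_unique unfolding weakly_tendsto_def o_def by blast
    ultimately have "inner (l - l') (l - l') = 0" by (simp add: inner_diff_left)
    then show ?thesis by simp
  qed
  obtain l r where lr: "strict_mono r" "weakly_tendsto (u \<circ> r) l"
    using bounded_imp_weakly_convergent_subsequence[of u, OF bd] by blast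
  then have l: "l \<in> weak_cluster_points u" by (auto simp: weak_cluster_points_def)
  have "weakly_tendsto u l"
    unfolding weakly_tendsto_def
  proof (intro allI, rule ccontr)
    fix y assume "\<not> (\<lambda>n. inner (u n) y) \<longlonglongrightarrow> inner l y"
    then obtain e where e: "e > 0" "\<And>N. \<exists>n\<ge>N. dist (inner (u n) y) (inner l y) \<ge> e"
      unfolding lim_sequentially by (meson not_less)
    \<comment> \<open>A subsequence that stays away from \<open>\<langle>l, y\<rangle>\<close> would have a further weak cluster point.\<close>
    then have "infinite {n. dist (inner (u n) y) (inner l y) \<ge> e}"
      unfolding infinite_nat_iff_unbounded_le by blast
    then obtain s :: "nat \<Rightarrow> nat" where s: "strict_mono s" "\<And>n. dist (inner (u (s n)) y) (inner l y) \<ge> e"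
      using infinite_enumerate by blast
    obtain l' r' where r': "strict_mono r'" "weakly_tendsto ((u \<circ> s) \<circ> r') l'"
      using bounded_imp_weakly_convergent_subsequence[of "u \<circ> s" "sqrt K + norm z"] bd
      unfolding comp_apply by blast
    have "l' \<in> weak_cluster_points u"
      using strict_mono_o[OF s(1) r'(1)] r'(2) by (auto simp: weak_cluster_points_def o_assoc intro!: exI[of _ "s \<circ> r'"])
    then have "(\<lambda>n. inner (u (s (r' n))) y) \<longlonglongrightarrow> inner l y"
      using unique[OF _ l] r'(2) by (auto simp: weakly_tendsto_def)
    then obtain n where "dist (inner (u (s (r' n))) y) (inner l y) < e"
      using e(1) unfolding lim_sequentially by blast
    then show False using s(2)[of "r' n"] by simp
  qed
  then show ?thesis using l cluster by blast
qed

text \<open>Pettis' theorem for separable inner product spaces: a closed ball is the intersection of countably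
  many half-spaces \<open>\<langle>v - c, d\<rangle> \<le> r \<parallel>d\<parallel>\<close>, and an open set is a countable union of closed balls.\<close>

lemma borel_measurable_weakly:
  fixes f :: "'a \<Rightarrow> 'h::{real_inner, second_countable_topology}"
  assumes meas: "\<And>y. (\<lambda>\<omega>. inner (f \<omega>) y) \<in> borel_measurable M"
  shows "f \<in> borel_measurable M"
proof (rule borel_measurableI)
  obtain D :: "'h set" where D: "countable D" "\<And>U. open U \<Longrightarrow> U \<noteq> {} \<Longrightarrow> \<exists>d\<in>D. d \<in> U"
    using countable_dense_setE by blast
  have cball: "f -` cball c r \<inter> space M \<in> sets M" if r: "r \<ge> 0" for c r
  proof -
    have iff: "v \<in> cball c r \<longleftrightarrow> (\<forall>d\<in>D. inner v d - inner c d \<le> r * norm d)" for v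
    proof
      assume "v \<in> cball c r"
      then have "norm (v - c) \<le> r" by (simp add: dist_norm norm_minus_commute)
      then have "norm (v - c) * norm d \<le> r * norm d" for d :: 'h by (rule mult_right_mono) simp
      then show "\<forall>d\<in>D. inner v d - inner c d \<le> r * norm d"
        using norm_cauchy_schwarz[of "v - c"] by (metis inner_diff_left order_trans)
    next
      assume *: "\<forall>d\<in>D. inner v d - inner c d \<le> r * norm d"
      let ?U = "{d. r * norm d < inner v d - inner c d}"
      have "open ?U" by (intro open_Collect_less continuous_intros)
      then have "?U = {}" using D(2)[of ?U] * by force
      then have "v - c \<notin> ?U" by blast
      then have "inner (v - c) (v - c) \<le> r * norm (v - c)" by (simp add: inner_diff_left not_less)
      then have "norm (v - c) * norm (v - c) \<le> r * norm (v - c)"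
        by (simp add: dot_square_norm power2_eq_square)
      then have "norm (v - c) \<le> r" using r by (cases "v = c") auto
      then show "v \<in> cball c r" by (simp add: dist_norm norm_minus_commute)
    qed
    have "f -` cball c r \<inter> space M
        = {\<omega>\<in>space M. \<forall>d\<in>D. inner (f \<omega>) d - inner c d \<le> r * norm d}"
      using iff by auto
    also have "\<dots> \<in> sets M"
      by (intro sets.sets_Collect_countable_All' D(1) borel_measurable_le borel_measurable_diff
          borel_measurable_const meas)
    finally show ?thesis .
  qed
  fix U :: "'h set" assume U: "open U"
  define I where "I = {(d, n::nat). d \<in> D \<and> cball d (inverse (real (Suc n))) \<subseteq> U}"
  have "I \<subseteq> D \<times> UNIV" by (auto simp: I_def)
  then have cI: "countable I" by (rule countable_subset) (use D(1) in simp)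
  have "\<exists>(d, n)\<in>I. v \<in> cball d (inverse (real (Suc n)))" if v: "v \<in> U" for v
  proof -
    obtain e where e: "e > 0" "ball v e \<subseteq> U" using openE[OF U v] by blast
    obtain n where n: "inverse (real (Suc n)) < e / 2"
      using reals_Archimedean[of "e / 2"] e by auto
    have "ball v (inverse (real (Suc n))) \<noteq> {}" by simp
    then obtain d where d: "d \<in> D" "dist v d < inverse (real (Suc n))"
      using D(2)[of "ball v (inverse (real (Suc n)))"] by auto
    have "cball d (inverse (real (Suc n))) \<subseteq> ball v e"
    proof
      fix w assume "w \<in> cball d (inverse (real (Suc n)))"
      then have "dist v w < e" using d n dist_triangle[of v w d] by simp
      then show "w \<in> ball v e" by simp
    qed
    then have "(d, n) \<in> I" using d e by (auto simp: I_def)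
    then show ?thesis using d by (auto simp: dist_commute intro: less_imp_le)
  qed
  then have "U = (\<Union>(d, n)\<in>I. cball d (inverse (real (Suc n))))" by (auto simp: I_def)
  then have "f -` U \<inter> space M = (\<Union>(d, n)\<in>I. f -` cball d (inverse (real (Suc n))) \<inter> space M)"
    by auto
  also have "\<dots> \<in> sets M" using cball by (intro sets.countable_UN' cI) auto
  finally show "f -` U \<inter> space M \<in> sets M" .
qed

text \<open>The distances to \<open>z\<close> and to \<open>d\<close> differ by at most \<open>\<parallel>z - d\<parallel>\<close>, uniformly in \<open>n\<close>. This reduces
  almost sure convergence of the distances to uncountably many points to countably many null sets.\<close>

lemma convergent_norm_diff_closure:
  fixes u :: "nat \<Rightarrow> 'h::real_normed_vector"
  assumes conv: "\<And>d. d \<in> D \<Longrightarrow> convergent (\<lambda>n. (norm (u n - d))\<^sup>2)" and z: "z \<in> closure D"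
  shows "convergent (\<lambda>n. (norm (u n - z))\<^sup>2)"
proof -
  have conv': "convergent (\<lambda>n. norm (u n - d))" if "d \<in> D" for d
  proof -
    obtain c where "(\<lambda>n. (norm (u n - d))\<^sup>2) \<longlonglongrightarrow> c" using conv[OF \<open>d \<in> D\<close>] by (auto simp: convergent_def)
    then have "(\<lambda>n. sqrt ((norm (u n - d))\<^sup>2)) \<longlonglongrightarrow> sqrt c" by (rule tendsto_real_sqrt)
    then show ?thesis by (auto simp: convergent_def)
  qed
  have "Cauchy (\<lambda>n. norm (u n - z))"
  proof (rule metric_CauchyI)
    fix e :: real assume "0 < e"
    then have e: "0 < e / 3" by simp
    then obtain d where d: "d \<in> D" "dist d z < e / 3"
      using z unfolding closure_approachable by blast
    have close: "\<bar>norm (u i - z) - norm (u i - d)\<bar> < e / 3" for i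
      using norm_triangle_ineq3[of "u i - z" "u i - d"] d(2) by (simp add: dist_norm)
    have "Cauchy (\<lambda>n. norm (u n - d))" using conv'[OF d(1)] by (simp add: Cauchy_convergent_iff)
    then obtain N where N: "\<And>i j. i \<ge> N \<Longrightarrow> j \<ge> N \<Longrightarrow> dist (norm (u i - d)) (norm (u j - d)) < e / 3"
      using metric_CauchyD e by blast
    have "dist (norm (u i - z)) (norm (u j - z)) < e" if "i \<ge> N" "j \<ge> N" for i j
      using close[of i] close[of j] N[OF that] unfolding dist_real_def by linarith
    then show "\<exists>N. \<forall>i\<ge>N. \<forall>j\<ge>N. dist (norm (u i - z)) (norm (u j - z)) < e" by blast
  qed
  then obtain c where "(\<lambda>n. norm (u n - z)) \<longlonglongrightarrow> c" by (auto simp: Cauchy_convergent_iff convergent_def)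
  then have "(\<lambda>n. (norm (u n - z))\<^sup>2) \<longlonglongrightarrow> c\<^sup>2" by (rule tendsto_power)
  then show ?thesis by (auto simp: convergent_def)
qed

lemma weak_lower_semicontinuity:
  assumes "weakly_tendsto u l"
  shows "ennreal ((norm l)\<^sup>2) \<le> liminf (\<lambda>n. ennreal ((norm (u n))\<^sup>2))"
proof -
  have below: "2 * inner (u n) l - (norm l)\<^sup>2 \<le> (norm (u n))\<^sup>2" for n
  proof -
    have "0 \<le> (norm (u n - l))\<^sup>2" by simp
    then show ?thesis by (simp add: power2_norm_eq_inner inner_simps inner_commute)
  qed
  have "(\<lambda>n. inner (u n) l) \<longlonglongrightarrow> inner l l" using assms by (simp add: weakly_tendsto_def)
  then have "(\<lambda>n. 2 * inner (u n) l - (norm l)\<^sup>2) \<longlonglongrightarrow> 2 * inner l l - (norm l)\<^sup>2"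
    by (intro tendsto_diff tendsto_mult tendsto_const)
  then have "(\<lambda>n. ennreal (2 * inner (u n) l - (norm l)\<^sup>2)) \<longlonglongrightarrow> ennreal ((norm l)\<^sup>2)"
    by (intro tendsto_ennrealI) (simp add: power2_norm_eq_inner)
  then have "ennreal ((norm l)\<^sup>2) = liminf (\<lambda>n. ennreal (2 * inner (u n) l - (norm l)\<^sup>2))"
    by (intro lim_imp_Liminf[symmetric]) auto
  also have "\<dots> \<le> liminf (\<lambda>n. ennreal ((norm (u n))\<^sup>2))"
    by (intro Liminf_mono always_eventually allI ennreal_leI below)
  finally show ?thesis .
qed

section \<open>Almost sure convergence of supermartingales with summable drift\<close>

text \<open>The states of a buyer who buys when the price \<open>s\<close> drops below \<open>a\<close> and sells when it next exceeds \<open>b\<close>;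
  an upcrossing is counted at each sale. The state at time \<open>n\<close> depends on \<open>s 0, \<dots>, s n\<close> only, which makes
  the strategy predictable.\<close>

primrec holding :: "real \<Rightarrow> real \<Rightarrow> (nat \<Rightarrow> real) \<Rightarrow> nat \<Rightarrow> bool" where
  "holding a b s 0 \<longleftrightarrow> s 0 < a"
| "holding a b s (Suc n) \<longleftrightarrow> (if holding a b s n then s (Suc n) \<le> b else s (Suc n) < a)"

primrec upcrossings :: "real \<Rightarrow> real \<Rightarrow> (nat \<Rightarrow> real) \<Rightarrow> nat \<Rightarrow> nat" where
  "upcrossings a b s 0 = 0"
| "upcrossings a b s (Suc n) =
     upcrossings a b s n + (if holding a b s n \<and> b < s (Suc n) then 1 else 0)"

lemma upcrossings_le: "upcrossings a b s n \<le> n"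
  by (induction n) auto

lemma mono_upcrossings: "mono (upcrossings a b s)"
  by (rule incseq_SucI) simp

text \<open>Each completed transaction earns at least \<open>b - a\<close>, and the open one, bought for less than \<open>a\<close>, is
  worth at least \<open>s n - a\<close>.\<close>

lemma upcrossing_gain:
  assumes "a < b"
  shows "(b - a) * upcrossings a b s n + (if holding a b s n then s n - a else 0)
       \<le> (\<Sum>k<n. of_bool (holding a b s k) * (s (Suc k) - s k))"
proof (induction n)
  case (Suc n)
  then show ?case using assms by (auto simp: algebra_simps split: if_splits)
qed auto

text \<open>After the last upcrossing the buyer who holds never sells, so once \<open>s\<close> has dropped below \<open>a\<close> it never
  exceeds \<open>b\<close> again.\<close>

lemma bounded_upcrossings_imp_not_oscillating:
  assumes "a < b" and bd: "\<And>n. upcrossings a b s n \<le> N"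
    and low: "\<exists>\<^sub>F n in sequentially. s n < a" and high: "\<exists>\<^sub>F n in sequentially. b < s n"
  shows False
proof -
  obtain m where m: "\<And>n. upcrossings a b s n \<le> upcrossings a b s m"
  proof -
    have fin: "finite (range (upcrossings a b s))"
      by (rule finite_subset[of _ "{..N}"]) (use bd in auto)
    then have "Max (range (upcrossings a b s)) \<in> range (upcrossings a b s)" by (intro Max_in) auto
    then obtain m where "upcrossings a b s m = Max (range (upcrossings a b s))" by force
    then show ?thesis using that[of m] fin by simp
  qed
  have const: "upcrossings a b s n = upcrossings a b s m" if "m \<le> n" for n
    using m[of n] monoD[OF mono_upcrossings that, of a b s] by simp
  have stay: "s (Suc n) \<le> b" if "m \<le> n" "holding a b s n" for n
    using const[OF that(1)] const[of "Suc n"] that by (auto split: if_splits)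
  obtain i where i: "i \<ge> m" "s i < a"
    using low unfolding frequently_sequentially by blast
  have "holding a b s i" using i \<open>a < b\<close> by (cases i) auto
  have hold: "holding a b s n" if "i \<le> n" for n
    using that
  proof (induction n rule: dec_induct)
    case (step n)
    then show ?case using stay[of n] i by simp
  qed fact
  obtain j where j: "j \<ge> Suc i" "b < s j"
    using high unfolding frequently_sequentially by blast
  then obtain j' where "j = Suc j'" "i \<le> j'" by (cases j) auto
  then show False using stay[of j'] hold[of j'] i j(2) by simp
qed

text \<open>Rational levels suffice to separate the lower from the upper limit; the bound \<open>K\<close>, taken infinitely
  often, rules out divergence to infinity.\<close>

lemma not_oscillating_imp_convergent:
  fixes s :: "nat \<Rightarrow> real"
  assumes nonneg: "\<And>n. 0 \<le> s n" and freq: "\<exists>\<^sub>F n in sequentially. s n < K"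
    and no: "\<And>a b. a \<in> \<rat> \<Longrightarrow> b \<in> \<rat> \<Longrightarrow> a < b \<Longrightarrow>
        \<not> ((\<exists>\<^sub>F n in sequentially. s n < a) \<and> (\<exists>\<^sub>F n in sequentially. b < s n))"
  shows "convergent s"
proof -
  \<comment> \<open>Not oscillating between two rationals above \<open>K\<close> turns the frequent bound into an eventual one.\<close>
  obtain K' where K': "K' \<in> \<rat>" "K < K'" using Rats_dense_in_real[of K "K + 1"] by auto
  obtain K'' where K'': "K'' \<in> \<rat>" "K' < K''" using Rats_dense_in_real[of K' "K' + 1"] by auto
  have "\<exists>\<^sub>F n in sequentially. s n < K'"
    using freq K'(2) by (auto elim!: frequently_elim1)
  then have "\<not> (\<exists>\<^sub>F n in sequentially. K'' < s n)" using no[OF K'(1) K''] by blast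
  then obtain N where N: "\<And>n. n \<ge> N \<Longrightarrow> s n \<le> K''"
    by (auto simp: not_frequently eventually_sequentially not_less)
  define B where "B = Max (insert K'' (s ` {..N}))"
  have B: "s n \<le> B" for n
  proof (cases "n \<le> N")
    case False
    then have "s n \<le> K''" using N by simp
    also have "\<dots> \<le> B" by (auto simp: B_def)
    finally show ?thesis .
  next
    case True
    then show ?thesis unfolding B_def by (intro Max_ge) auto
  qed
  let ?e = "\<lambda>n. ereal (s n)"
  have le: "Liminf sequentially ?e \<le> Limsup sequentially ?e" by (intro Liminf_le_Limsup) simp
  have lo: "0 \<le> Liminf sequentially ?e" by (intro Liminf_bounded) (auto simp: nonneg)
  have hi: "Limsup sequentially ?e \<le> ereal B" by (intro Limsup_bounded) (auto simp: B)
  have eq: "Liminf sequentially ?e = Limsup sequentially ?e"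
  proof (rule ccontr)
    assume "Liminf sequentially ?e \<noteq> Limsup sequentially ?e"
    with le have "Liminf sequentially ?e < Limsup sequentially ?e" by simp
    then obtain b' where b': "Liminf sequentially ?e < ereal b'" "ereal b' < Limsup sequentially ?e"
      using ereal_dense2 by blast
    obtain a' where a': "Liminf sequentially ?e < ereal a'" "a' < b'"
      using ereal_dense2[OF b'(1)] by auto
    obtain a where a: "a \<in> \<rat>" "a' < a" "a < b'" using Rats_dense_in_real[OF a'(2)] by auto
    obtain b where b: "b \<in> \<rat>" "a < b" "b < b'" using Rats_dense_in_real[OF a(3)] by auto
    have "\<exists>\<^sub>F n in sequentially. s n < a"
    proof (rule ccontr)
      assume "\<not> ?thesis"
      then have "\<forall>\<^sub>F n in sequentially. ereal a \<le> ?e n" by (simp add: not_frequently not_less)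
      then have "ereal a \<le> Liminf sequentially ?e" by (rule Liminf_bounded)
      also have "\<dots> < ereal a'" by (rule a')
      finally show False using a by simp
    qed
    moreover have "\<exists>\<^sub>F n in sequentially. b < s n"
    proof (rule ccontr)
      assume "\<not> ?thesis"
      then have "\<forall>\<^sub>F n in sequentially. ?e n \<le> ereal b" by (simp add: not_frequently not_less)
      then have "Limsup sequentially ?e \<le> ereal b" by (rule Limsup_bounded)
      with b'(2) have "ereal b' < ereal b" by (rule less_le_trans)
      then show False using b by simp
    qed
    ultimately show False using no[OF a(1) b(1,2)] by blast
  qed
  have lim: "?e \<longlonglongrightarrow> Limsup sequentially ?e"
    by (rule Liminf_eq_Limsup) (auto simp: eq)
  obtain l where "Limsup sequentially ?e = ereal l"
    using lo hi eq by (cases "Limsup sequentially ?e") auto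
  with lim have "s \<longlonglongrightarrow> l" by simp
  then show ?thesis by (auto simp: convergent_def)
qed

text \<open>Nonnegative adapted processes with \<open>E(S (n+1) | F n) \<le> S n + b n\<close> almost surely, a special case of the
  setting of Robbins and Siegmund. The inequality is stated through averages over the events of
  \<open>F n\<close>, which is the form used by both the trading strategy and the stopping argument below.\<close>

locale quasi_supermartingale = prob_space M for M :: "'a measure" +
  fixes F :: "nat \<Rightarrow> 'a measure" and S b :: "nat \<Rightarrow> 'a \<Rightarrow> real"
  assumes subalgebra: "\<And>n. subalgebra M (F n)"
    and filtration: "\<And>m n. m \<le> n \<Longrightarrow> sets (F m) \<subseteq> sets (F n)"
    and adapted: "\<And>n. S n \<in> borel_measurable (F n)" "\<And>n. b n \<in> borel_measurable (F n)"
    and int: "\<And>n. integrable M (S n)" "\<And>n. integrable M (b n)"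
    and nonneg: "\<And>n \<omega>. 0 \<le> S n \<omega>" "\<And>n \<omega>. 0 \<le> b n \<omega>"
    and step: "\<And>n A. A \<in> sets (F n) \<Longrightarrow>
        (LINT \<omega>:A|M. S (Suc n) \<omega>) \<le> (LINT \<omega>:A|M. S n \<omega>) + (LINT \<omega>:A|M. b n \<omega>)"
begin

lemma space_F: "space (F n) = space M"
  using subalgebra[of n] by (simp add: subalgebra_def)

lemma sets_F_sets_M: "A \<in> sets (F n) \<Longrightarrow> A \<in> sets M"
  using subalgebra[of n] by (auto simp: subalgebra_def)

lemma F_mono: "m \<le> n \<Longrightarrow> f \<in> borel_measurable (F m) \<Longrightarrow> f \<in> borel_measurable (F n)"
  using filtration space_F by (auto simp: measurable_def)

lemma set_integrable_F:
  fixes f :: "'a \<Rightarrow> real"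
  shows "A \<in> sets (F n) \<Longrightarrow> integrable M f \<Longrightarrow> set_integrable M A f"
  unfolding set_integrable_def by (intro integrable_mult_indicator sets_F_sets_M)

lemma holding_sets:
  "{\<omega>\<in>space M. holding u v (\<lambda>k. S k \<omega>) n} \<in> sets (F n)"
proof (induction n)
  case 0
  have [measurable]: "S 0 \<in> borel_measurable (F 0)" by (rule adapted)
  have "{\<omega>\<in>space (F 0). S 0 \<omega> < u} \<in> sets (F 0)" by measurable
  then show ?case by (simp add: space_F)
next
  case (Suc n)
  have [measurable]: "S (Suc n) \<in> borel_measurable (F (Suc n))" by (rule adapted)
  have [measurable]: "Measurable.pred (F (Suc n)) (\<lambda>\<omega>. holding u v (\<lambda>k. S k \<omega>) n)"
    using Suc filtration[of n "Suc n"] by (auto simp: pred_def space_F)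
  have "{\<omega>\<in>space (F (Suc n)). if holding u v (\<lambda>k. S k \<omega>) n then S (Suc n) \<omega> \<le> v else S (Suc n) \<omega> < u}
      \<in> sets (F (Suc n))"
    by measurable
  then show ?case by (simp add: space_F)
qed

lemma LINT_S_le: "(LINT \<omega>|M. S n \<omega>) \<le> (LINT \<omega>|M. S 0 \<omega>) + (\<Sum>k<n. LINT \<omega>|M. b k \<omega>)"
proof (induction n)
  case (Suc n)
  have "space M \<in> sets (F n)" using sets.top[of "F n"] by (simp add: space_F)
  from step[OF this] Suc show ?case by (simp add: set_integral_space int)
qed simp

lemma integrable_upcrossings: "integrable M (\<lambda>\<omega>. real (upcrossings u v (\<lambda>k. S k \<omega>) n))"
proof (rule integrable_const_bound[of _ "real n"])
  have [measurable]: "Measurable.pred M (\<lambda>\<omega>. holding u v (\<lambda>k. S k \<omega>) k)" for k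
    unfolding pred_def by (rule sets_F_sets_M[OF holding_sets])
  have [measurable]: "S k \<in> borel_measurable M" for k
    by (rule borel_measurable_integrable[OF int(1)])
  show "(\<lambda>\<omega>. real (upcrossings u v (\<lambda>k. S k \<omega>) n)) \<in> borel_measurable M"
    by (induction n) (simp_all, measurable)
qed (auto simp: upcrossings_le)

text \<open>Doob's upcrossing inequality, with a correction for the drift \<open>b\<close>. The expected gain of the strategy is
  at most the accumulated drift, and by \<open>upcrossing_gain\<close> and nonnegativity of \<open>S\<close> it is at least
  \<open>(v - u)\<close> times the expected number of upcrossings, minus \<open>u\<close>.\<close>

lemma LINT_upcrossings_le:
  assumes "0 \<le> u" "u < v"
  shows "(v - u) * (LINT \<omega>|M. real (upcrossings u v (\<lambda>k. S k \<omega>) n)) \<le> u + (\<Sum>k<n. LINT \<omega>|M. b k \<omega>)"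
proof -
  define H where "H k = {\<omega>\<in>space M. holding u v (\<lambda>k. S k \<omega>) k}" for k
  have H: "H k \<in> sets (F k)" for k unfolding H_def by (rule holding_sets)
  have HM: "H k \<in> sets M" for k using H sets_F_sets_M by blast
  have inc: "integrable M (\<lambda>\<omega>. indicator (H k) \<omega> *\<^sub>R (S (Suc k) \<omega> - S k \<omega>))" for k
    using int HM by (intro integrable_mult_indicator) auto
  have gain: "(LINT \<omega>|M. indicator (H k) \<omega> *\<^sub>R (S (Suc k) \<omega> - S k \<omega>)) \<le> (LINT \<omega>|M. b k \<omega>)" for k
  proof -
    have "(LINT \<omega>|M. indicator (H k) \<omega> *\<^sub>R (S (Suc k) \<omega> - S k \<omega>))
        = (LINT \<omega>:H k|M. S (Suc k) \<omega>) - (LINT \<omega>:H k|M. S k \<omega>)"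
      using set_integral_diff(2)[OF set_integrable_F[OF H int(1)] set_integrable_F[OF H int(1)]]
      by (simp add: set_lebesgue_integral_def)
    also have "\<dots> \<le> (LINT \<omega>:H k|M. b k \<omega>)" using step[OF H] by (simp add: algebra_simps)
    also have "\<dots> \<le> (LINT \<omega>|M. b k \<omega>)"
      unfolding set_lebesgue_integral_def
      using int HM nonneg by (intro integral_mono integrable_mult_indicator) (auto simp: indicator_def)
    finally show ?thesis .
  qed
  have "(v - u) * (LINT \<omega>|M. real (upcrossings u v (\<lambda>k. S k \<omega>) n))
      = (LINT \<omega>|M. (v - u) * real (upcrossings u v (\<lambda>k. S k \<omega>) n))" by simp
  also have "\<dots> \<le> (LINT \<omega>|M. u + (\<Sum>k<n. indicator (H k) \<omega> *\<^sub>R (S (Suc k) \<omega> - S k \<omega>)))"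
  proof (intro integral_mono)
    fix \<omega> assume \<omega>: "\<omega> \<in> space M"
    have "(\<Sum>k<n. of_bool (holding u v (\<lambda>k. S k \<omega>) k) * (S (Suc k) \<omega> - S k \<omega>))
        = (\<Sum>k<n. indicator (H k) \<omega> *\<^sub>R (S (Suc k) \<omega> - S k \<omega>))"
      using \<omega> by (intro sum.cong) (auto simp: H_def indicator_def)
    then show "(v - u) * real (upcrossings u v (\<lambda>k. S k \<omega>) n)
        \<le> u + (\<Sum>k<n. indicator (H k) \<omega> *\<^sub>R (S (Suc k) \<omega> - S k \<omega>))"
      using upcrossing_gain[OF \<open>u < v\<close>, of "\<lambda>k. S k \<omega>" n] nonneg(1)[of n \<omega>] \<open>0 \<le> u\<close>
      by (auto split: if_splits)
  next
    show "integrable M (\<lambda>\<omega>. u + (\<Sum>k<n. indicator (H k) \<omega> *\<^sub>R (S (Suc k) \<omega> - S k \<omega>)))"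
      by (intro Bochner_Integration.integrable_add Bochner_Integration.integrable_sum inc) simp
  qed (use integrable_upcrossings in simp)
  also have "\<dots> = u + (\<Sum>k<n. LINT \<omega>|M. indicator (H k) \<omega> *\<^sub>R (S (Suc k) \<omega> - S k \<omega>))"
    unfolding Bochner_Integration.integral_add[OF integrable_const
        Bochner_Integration.integrable_sum[OF inc]] Bochner_Integration.integral_sum[OF inc]
    by (simp add: prob_space)
  also have "\<dots> \<le> u + (\<Sum>k<n. LINT \<omega>|M. b k \<omega>)" using gain by (intro add_left_mono sum_mono)
  finally show ?thesis .
qed

lemma AE_bounded_upcrossings:
  assumes "0 \<le> u" "u < v" and sum: "summable (\<lambda>k. LINT \<omega>|M. b k \<omega>)"
  shows "AE \<omega> in M. \<exists>N. \<forall>n. upcrossings u v (\<lambda>k. S k \<omega>) n \<le> N"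
proof -
  let ?U = "\<lambda>n \<omega>. ennreal (real (upcrossings u v (\<lambda>k. S k \<omega>) n))"
  define C where "C = (u + (\<Sum>k. LINT \<omega>|M. b k \<omega>)) / (v - u)"
  have UM: "?U n \<in> borel_measurable M" for n using integrable_upcrossings[of u v n] by auto
  have "(\<integral>\<^sup>+\<omega>. (SUP n. ?U n \<omega>) \<partial>M) = (SUP n. \<integral>\<^sup>+\<omega>. ?U n \<omega> \<partial>M)"
    by (intro nn_integral_monotone_convergence_SUP UM incseq_SucI le_funI ennreal_leI) simp
  also have "\<dots> \<le> ennreal C"
  proof (rule SUP_least)
    fix n
    have "(\<Sum>k<n. LINT \<omega>|M. b k \<omega>) \<le> (\<Sum>k. LINT \<omega>|M. b k \<omega>)"
      using nonneg by (intro sum_le_suminf sum) auto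
    then have "(v - u) * (LINT \<omega>|M. real (upcrossings u v (\<lambda>k. S k \<omega>) n)) \<le> u + (\<Sum>k. LINT \<omega>|M. b k \<omega>)"
      using LINT_upcrossings_le[OF assms(1,2), of n] by linarith
    then have "(LINT \<omega>|M. real (upcrossings u v (\<lambda>k. S k \<omega>) n)) \<le> C"
      using \<open>u < v\<close> by (simp add: C_def field_simps)
    then show "(\<integral>\<^sup>+\<omega>. ?U n \<omega> \<partial>M) \<le> ennreal C"
      by (subst nn_integral_eq_integral[OF integrable_upcrossings]) (auto intro: ennreal_leI)
  qed
  finally have "(\<integral>\<^sup>+\<omega>. (SUP n. ?U n \<omega>) \<partial>M) \<noteq> \<infinity>" by (auto simp: top_unique)
  then have "AE \<omega> in M. (SUP n. ?U n \<omega>) \<noteq> \<infinity>"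
    using UM by (intro nn_integral_PInf_AE) auto
  then show ?thesis
  proof eventually_elim
    fix \<omega> assume "(SUP n. ?U n \<omega>) \<noteq> \<infinity>"
    then obtain c where c: "(SUP n. ?U n \<omega>) = ennreal c" "c \<ge> 0"
      by (cases "SUP n. ?U n \<omega>") auto
    obtain N :: nat where N: "c \<le> real N" using real_arch_simple by blast
    have "upcrossings u v (\<lambda>k. S k \<omega>) n \<le> N" for n
    proof -
      have "?U n \<omega> \<le> ennreal c" unfolding c(1)[symmetric] by (rule SUP_upper) simp
      then have "real (upcrossings u v (\<lambda>k. S k \<omega>) n) \<le> c" using c(2) by (simp only: ennreal_le_iff)
      then show ?thesis using N by linarith
    qed
    then show "\<exists>N. \<forall>n. upcrossings u v (\<lambda>k. S k \<omega>) n \<le> N" by blast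
  qed
qed

text \<open>Fatou's lemma makes the lower limit of \<open>S n\<close> integrable, hence finite almost surely.\<close>

lemma AE_frequently_bounded:
  assumes sum: "summable (\<lambda>k. LINT \<omega>|M. b k \<omega>)"
  shows "AE \<omega> in M. \<exists>K. \<exists>\<^sub>F n in sequentially. S n \<omega> < K"
proof -
  define C where "C = (LINT \<omega>|M. S 0 \<omega>) + (\<Sum>k. LINT \<omega>|M. b k \<omega>)"
  have SM[measurable]: "S n \<in> borel_measurable M" for n by (rule borel_measurable_integrable[OF int(1)])
  have bd: "(\<integral>\<^sup>+\<omega>. ennreal (S n \<omega>) \<partial>M) \<le> ennreal C" for n
  proof -
    have "(\<Sum>k<n. LINT \<omega>|M. b k \<omega>) \<le> (\<Sum>k. LINT \<omega>|M. b k \<omega>)"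
      using nonneg by (intro sum_le_suminf sum) auto
    then show ?thesis using LINT_S_le[of n] nonneg
      by (subst nn_integral_eq_integral[OF int(1)]) (auto simp: C_def intro!: ennreal_leI)
  qed
  have "(\<integral>\<^sup>+\<omega>. liminf (\<lambda>n. ennreal (S n \<omega>)) \<partial>M) \<le> liminf (\<lambda>n. \<integral>\<^sup>+\<omega>. ennreal (S n \<omega>) \<partial>M)"
    by (rule nn_integral_liminf) simp
  also have "\<dots> \<le> limsup (\<lambda>n. \<integral>\<^sup>+\<omega>. ennreal (S n \<omega>) \<partial>M)" by (rule Liminf_le_Limsup) simp
  also have "\<dots> \<le> ennreal C" by (rule Limsup_bounded) (simp add: bd)
  finally have "(\<integral>\<^sup>+\<omega>. liminf (\<lambda>n. ennreal (S n \<omega>)) \<partial>M) \<noteq> \<infinity>" by (auto simp: top_unique)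
  then have "AE \<omega> in M. liminf (\<lambda>n. ennreal (S n \<omega>)) \<noteq> \<infinity>"
    by (intro nn_integral_PInf_AE) auto
  then show ?thesis
  proof eventually_elim
    fix \<omega> assume fin: "liminf (\<lambda>n. ennreal (S n \<omega>)) \<noteq> \<infinity>"
    show "\<exists>K. \<exists>\<^sub>F n in sequentially. S n \<omega> < K"
    proof (rule ccontr)
      assume "\<not> ?thesis"
      then have ev: "\<forall>\<^sub>F n in sequentially. K \<le> S n \<omega>" for K by (simp add: not_frequently not_less)
      have "ennreal (real k) \<le> liminf (\<lambda>n. ennreal (S n \<omega>))" for k
        by (intro Liminf_bounded eventually_mono[OF ev[of "real k"]] ennreal_leI)
      then have "of_nat k \<le> liminf (\<lambda>n. ennreal (S n \<omega>))" for k by (simp add: ennreal_of_nat_eq_real_of_nat)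
      moreover have "\<exists>k. liminf (\<lambda>n. ennreal (S n \<omega>)) < of_nat k"
        by (rule ennreal_Ex_less_of_nat) (use fin in \<open>simp add: less_top\<close>)
      ultimately show False by (meson not_less)
    qed
  qed
qed

lemma AE_convergent_of_summable_expectation:
  assumes sum: "summable (\<lambda>k. LINT \<omega>|M. b k \<omega>)"
  shows "AE \<omega> in M. convergent (\<lambda>n. S n \<omega>)"
proof -
  let ?R = "{(u, v). u \<in> \<rat> \<and> v \<in> \<rat> \<and> 0 \<le> u \<and> u < (v::real)}"
  have "countable (\<rat> \<times> \<rat> :: (real \<times> real) set)" by (intro countable_SIGMA countable_rat)
  then have "countable ?R" by (rule countable_subset[rotated]) auto
  moreover have "AE \<omega> in M. \<exists>N. \<forall>n. upcrossings (fst p) (snd p) (\<lambda>k. S k \<omega>) n \<le> N" if "p \<in> ?R" for p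
    using that AE_bounded_upcrossings[OF _ _ sum] by auto
  ultimately have "AE \<omega> in M. \<forall>p\<in>?R. \<exists>N. \<forall>n. upcrossings (fst p) (snd p) (\<lambda>k. S k \<omega>) n \<le> N"
    by (intro AE_ball_countable[THEN iffD2] ballI)
  then show ?thesis using AE_frequently_bounded[OF sum]
  proof eventually_elim
    fix \<omega> assume U: "\<forall>p\<in>?R. \<exists>N. \<forall>n. upcrossings (fst p) (snd p) (\<lambda>k. S k \<omega>) n \<le> N"
      and K: "\<exists>K. \<exists>\<^sub>F n in sequentially. S n \<omega> < K"
    obtain K where "\<exists>\<^sub>F n in sequentially. S n \<omega> < K" using K by blast
    with nonneg(1) show "convergent (\<lambda>n. S n \<omega>)"
    proof (rule not_oscillating_imp_convergent)
      fix u v :: real assume uv: "u \<in> \<rat>" "v \<in> \<rat>" "u < v"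
      show "\<not> ((\<exists>\<^sub>F n in sequentially. S n \<omega> < u) \<and> (\<exists>\<^sub>F n in sequentially. v < S n \<omega>))"
      proof
        assume osc: "(\<exists>\<^sub>F n in sequentially. S n \<omega> < u) \<and> (\<exists>\<^sub>F n in sequentially. v < S n \<omega>)"
        then obtain n where "S n \<omega> < u" using frequently_ex by blast
        then have "0 \<le> u" using nonneg(1)[of n \<omega>] by linarith
        then have "(u, v) \<in> ?R" using uv by simp
        from bspec[OF U this] obtain N where "\<And>n. upcrossings u v (\<lambda>k. S k \<omega>) n \<le> N"
          unfolding fst_conv snd_conv by blast
        then show False using osc bounded_upcrossings_imp_not_oscillating[OF uv(3)] by blast
      qed
    qed
  qed
qed

text \<open>Localization. Freezing \<open>S\<close> before the accumulated drift exceeds \<open>c\<close> gives a process of the same kind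
  whose total drift is at most \<open>c\<close>, so the previous lemma applies; it agrees with \<open>S\<close> on the event that
  the drift never exceeds \<open>c\<close>, and almost every point lies in such an event for some \<open>c\<close>. The freezing
  decision at time \<open>n\<close> uses \<open>b n\<close>, so it is essential that \<open>b n\<close> is \<open>F n\<close>-measurable.\<close>

lemma AE_convergent:
  assumes sum: "AE \<omega> in M. summable (\<lambda>k. b k \<omega>)"
  shows "AE \<omega> in M. convergent (\<lambda>n. S n \<omega>)"
proof -
  define G where "G c n = {\<omega>\<in>space M. (\<Sum>j\<le>n. b j \<omega>) \<le> real c}" for c n
  have GF: "G c n \<in> sets (F n)" for c n
  proof -
    have [measurable]: "b j \<in> borel_measurable (F n)" if "j \<in> {..n}" for j
      using F_mono[OF _ adapted(2)] that by auto
    have "{\<omega>\<in>space (F n). (\<Sum>j\<le>n. b j \<omega>) \<le> real c} \<in> sets (F n)" by measurable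
    then show ?thesis by (simp add: G_def space_F)
  qed
  have GM: "G c n \<in> sets M" for c n using GF sets_F_sets_M by blast
  have GSuc: "\<omega> \<in> G c n" if "\<omega> \<in> G c (Suc n)" for \<omega> c n
    using that nonneg(2)[of "Suc n" \<omega>] by (auto simp: G_def)
  \<comment> \<open>The frozen process: it follows \<open>S\<close> as long as the partial sums of \<open>b\<close> are at most \<open>c\<close>.\<close>
  define T where "T c = rec_nat (S 0) (\<lambda>n f \<omega>. if \<omega> \<in> G c n then S (Suc n) \<omega> else f \<omega>)" for c
  have T0: "T c 0 = S 0" and TSuc: "T c (Suc n) = (\<lambda>\<omega>. if \<omega> \<in> G c n then S (Suc n) \<omega> else T c n \<omega>)" for c n
    unfolding T_def by simp_all
  have T_eq: "T c n \<omega> = S n \<omega>" if "\<omega> \<in> G c n" for c n \<omega>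
    using that GSuc by (cases n) (auto simp: T0 TSuc)
  have TF: "T c n \<in> borel_measurable (F n)" for c n
  proof (induction n)
    case 0
    then show ?case by (simp add: T0 adapted)
  next
    case (Suc n)
    have [measurable]: "S (Suc n) \<in> borel_measurable (F (Suc n))" by (rule adapted)
    have [measurable]: "T c n \<in> borel_measurable (F (Suc n))" using F_mono[OF _ Suc] by simp
    have [measurable]: "G c n \<in> sets (F (Suc n))" using GF[of c n] filtration[of n "Suc n"] by auto
    show ?case unfolding TSuc by measurable
  qed
  have Tint: "integrable M (T c n)" for c n
  proof (induction n)
    case (Suc n)
    then have "integrable M (\<lambda>\<omega>. indicator (G c n) \<omega> *\<^sub>R S (Suc n) \<omega>
        + indicator (space M - G c n) \<omega> *\<^sub>R T c n \<omega>)"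
      using GM int by (intro Bochner_Integration.integrable_add integrable_mult_indicator) auto
    moreover have "integrable M (T c (Suc n)) \<longleftrightarrow> integrable M (\<lambda>\<omega>.
        indicator (G c n) \<omega> *\<^sub>R S (Suc n) \<omega> + indicator (space M - G c n) \<omega> *\<^sub>R T c n \<omega>)"
      by (intro Bochner_Integration.integrable_cong refl) (auto simp: TSuc indicator_def)
    ultimately show ?case by simp
  qed (simp add: T0 int)
  have stopped: "quasi_supermartingale M F (T c) (\<lambda>n \<omega>. indicator (G c n) \<omega> *\<^sub>R b n \<omega>)" for c
  proof unfold_locales
    fix n
    show "T c n \<in> borel_measurable (F n)" "integrable M (T c n)" by (rule TF Tint)+
    have [measurable]: "b n \<in> borel_measurable (F n)" "G c n \<in> sets (F n)" by (rule adapted GF)+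
    show "(\<lambda>\<omega>. indicator (G c n) \<omega> *\<^sub>R b n \<omega>) \<in> borel_measurable (F n)" by measurable
    show "integrable M (\<lambda>\<omega>. indicator (G c n) \<omega> *\<^sub>R b n \<omega>)"
      by (intro integrable_mult_indicator GM int)
    fix \<omega>
    show "0 \<le> T c n \<omega>" by (induction n) (auto simp: T0 TSuc nonneg)
    show "0 \<le> indicator (G c n) \<omega> *\<^sub>R b n \<omega>" by (simp add: nonneg)
  next
    fix n A assume A: "A \<in> sets (F n)"
    have AG: "A \<inter> G c n \<in> sets (F n)" and AG': "A - G c n \<in> sets (F n)" using A GF by auto
    have split: "(LINT \<omega>:A|M. f \<omega>) = (LINT \<omega>:A \<inter> G c n|M. f \<omega>) + (LINT \<omega>:A - G c n|M. f \<omega>)"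
      if "integrable M f" for f :: "'a \<Rightarrow> real"
      using set_integral_Un[OF _ set_integrable_F[OF AG that] set_integrable_F[OF AG' that]]
      by (simp add: Int_Diff_Un Int_Diff_disjoint)
    have cong: "(LINT \<omega>:B|M. f \<omega>) = (LINT \<omega>:B|M. g \<omega>)"
      if "B \<in> sets (F n)" "\<And>\<omega>. \<omega> \<in> B \<Longrightarrow> f \<omega> = g \<omega>" for B and f g :: "'a \<Rightarrow> real"
      using that sets_F_sets_M by (intro set_lebesgue_integral_cong) auto
    have "(LINT \<omega>:A|M. T c (Suc n) \<omega>)
        = (LINT \<omega>:A \<inter> G c n|M. S (Suc n) \<omega>) + (LINT \<omega>:A - G c n|M. T c n \<omega>)"
      unfolding split[OF Tint] by (intro arg_cong2[of _ _ _ _ "(+)"] cong AG AG') (auto simp: TSuc)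
    also have "(LINT \<omega>:A \<inter> G c n|M. S (Suc n) \<omega>)
        \<le> (LINT \<omega>:A \<inter> G c n|M. S n \<omega>) + (LINT \<omega>:A \<inter> G c n|M. b n \<omega>)"
      by (rule step[OF AG])
    also have "(LINT \<omega>:A \<inter> G c n|M. S n \<omega>) = (LINT \<omega>:A \<inter> G c n|M. T c n \<omega>)"
      by (rule cong[OF AG]) (simp add: T_eq)
    also have "(LINT \<omega>:A \<inter> G c n|M. b n \<omega>) = (LINT \<omega>:A|M. indicator (G c n) \<omega> *\<^sub>R b n \<omega>)"
      by (auto simp: set_lebesgue_integral_def indicator_def intro!: Bochner_Integration.integral_cong)
    finally show "(LINT \<omega>:A|M. T c (Suc n) \<omega>)
        \<le> (LINT \<omega>:A|M. T c n \<omega>) + (LINT \<omega>:A|M. indicator (G c n) \<omega> *\<^sub>R b n \<omega>)"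
      unfolding split[OF Tint[of c n]] by simp
  qed (use subalgebra filtration in auto)
  have "summable (\<lambda>k. LINT \<omega>|M. indicator (G c k) \<omega> *\<^sub>R b k \<omega>)" for c
  proof (rule bounded_imp_summable)
    fix n
    show "0 \<le> (LINT \<omega>|M. indicator (G c n) \<omega> *\<^sub>R b n \<omega>)"
      by (intro Bochner_Integration.integral_nonneg) (simp add: nonneg)
    have pt: "(\<Sum>k\<le>n. indicator (G c k) \<omega> *\<^sub>R b k \<omega>) \<le> real c" for \<omega>
    proof (induction n)
      case (Suc n)
      show ?case
      proof (cases "\<omega> \<in> G c (Suc n)")
        case True
        have "(\<Sum>k\<le>Suc n. indicator (G c k) \<omega> *\<^sub>R b k \<omega>) \<le> (\<Sum>k\<le>Suc n. b k \<omega>)"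
          by (intro sum_mono) (auto simp: indicator_def nonneg)
        then show ?thesis using True by (simp add: G_def)
      qed (use Suc in simp)
    next
      case 0
      show ?case by (cases "\<omega> \<in> G c 0") (auto simp: G_def)
    qed
    have "(\<Sum>k\<le>n. LINT \<omega>|M. indicator (G c k) \<omega> *\<^sub>R b k \<omega>)
        = (LINT \<omega>|M. (\<Sum>k\<le>n. indicator (G c k) \<omega> *\<^sub>R b k \<omega>))"
      by (intro Bochner_Integration.integral_sum[symmetric] integrable_mult_indicator GM int)
    also have "\<dots> \<le> (LINT \<omega>|M. real c)"
      by (intro integral_mono pt Bochner_Integration.integrable_sum integrable_mult_indicator GM int) simp
    finally show "(\<Sum>k\<le>n. LINT \<omega>|M. indicator (G c k) \<omega> *\<^sub>R b k \<omega>) \<le> real c"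
      by (simp add: prob_space)
  qed
  then have "AE \<omega> in M. convergent (\<lambda>n. T c n \<omega>)" for c
    by (rule quasi_supermartingale.AE_convergent_of_summable_expectation[OF stopped])
  then have "AE \<omega> in M. \<forall>c. convergent (\<lambda>n. T c n \<omega>)" by (simp add: AE_all_countable)
  with sum show ?thesis
  proof (rule AE_mp[OF AE_conjI], intro AE_I2 impI)
    fix \<omega> assume \<omega>: "\<omega> \<in> space M"
      and "summable (\<lambda>k. b k \<omega>) \<and> (\<forall>c. convergent (\<lambda>n. T c n \<omega>))"
    then have s: "summable (\<lambda>k. b k \<omega>)" and T: "\<And>c. convergent (\<lambda>n. T c n \<omega>)" by auto
    obtain c :: nat where c: "(\<Sum>k. b k \<omega>) \<le> real c" using real_arch_simple by blast
    have "\<omega> \<in> G c n" for n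
      using sum_le_suminf[OF s, of "{..n}"] nonneg(2) c \<omega> by (fastforce simp: G_def)
    then have "T c n \<omega> = S n \<omega>" for n by (rule T_eq)
    then show "convergent (\<lambda>n. S n \<omega>)" using T[of c] by simp
  qed
qed

end

section \<open>Square-integrable random vectors\<close>

lemma (in complete_measure) measurable_AE_eq:
  assumes f: "f \<in> measurable M N" and eq: "AE \<omega> in M. f \<omega> = g \<omega>"
    and g: "\<And>\<omega>. \<omega> \<in> space M \<Longrightarrow> g \<omega> \<in> space N"
  shows "g \<in> measurable M N"
proof (rule measurableI)
  fix A assume "A \<in> sets N"
  then have "f -` A \<inter> space M \<in> sets M" using f by (rule measurable_sets[rotated])
  then show "g -` A \<inter> space M \<in> sets M"
    by (rule in_sets_AE[rotated]) (use eq in \<open>auto elim: eventually_mono\<close>)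
qed (rule g)

lemma L2_iff:
  "f \<in> Lp_rv M 2 \<longleftrightarrow> f \<in> borel_measurable M \<and> integrable M (\<lambda>\<omega>. (norm (f \<omega>))\<^sup>2)"
proof -
  have "norm (f \<omega>) powr 2 = (norm (f \<omega>))\<^sup>2" for \<omega> by (cases "f \<omega> = 0") auto
  then show ?thesis by (simp add: Lp_rv_def)
qed

lemma L2_bound:
  assumes "f \<in> borel_measurable M" "integrable M h" "AE \<omega> in M. (norm (f \<omega>))\<^sup>2 \<le> h \<omega>"
  shows "f \<in> Lp_rv M 2"
  unfolding L2_iff using assms
  by (auto intro!: Bochner_Integration.integrable_bound[of M h] elim!: eventually_mono)

lemma norm_add_squared_le:
  fixes x y :: "'h::real_normed_vector"
  shows "(norm (x + y))\<^sup>2 \<le> 2 * (norm x)\<^sup>2 + 2 * (norm y)\<^sup>2"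
proof -
  have "(norm (x + y))\<^sup>2 \<le> (norm x + norm y)\<^sup>2" by (intro power_mono norm_triangle_ineq) simp
  also have "\<dots> \<le> 2 * (norm x)\<^sup>2 + 2 * (norm y)\<^sup>2"
    using zero_le_power2[of "norm x - norm y"] by (simp add: power2_sum power2_diff)
  finally show ?thesis .
qed

lemma L2_diff:
  fixes f g :: "'a \<Rightarrow> 'h::{real_inner, second_countable_topology}"
  assumes "f \<in> Lp_rv M 2" "g \<in> Lp_rv M 2"
  shows "(\<lambda>\<omega>. f \<omega> - g \<omega>) \<in> Lp_rv M 2"
proof (rule L2_bound)
  show "AE \<omega> in M. (norm (f \<omega> - g \<omega>))\<^sup>2 \<le> 2 * (norm (f \<omega>))\<^sup>2 + 2 * (norm (g \<omega>))\<^sup>2"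
    using norm_add_squared_le[of "f _" "- g _"] by simp
qed (use assms in \<open>auto simp: L2_iff\<close>)

lemma L2_inner:
  fixes f g :: "'a \<Rightarrow> 'h::{real_inner, second_countable_topology}"
  assumes "f \<in> Lp_rv M 2" "g \<in> Lp_rv M 2"
  shows "integrable M (\<lambda>\<omega>. inner (f \<omega>) (g \<omega>))"
proof (rule Bochner_Integration.integrable_bound)
  show "integrable M (\<lambda>\<omega>. (norm (f \<omega>))\<^sup>2 + (norm (g \<omega>))\<^sup>2)"
    using assms by (auto simp: L2_iff)
  have "\<bar>inner u v\<bar> \<le> (norm u)\<^sup>2 + (norm v)\<^sup>2" for u v :: 'h
  proof -
    have "2 * \<bar>inner u v\<bar> \<le> 2 * (norm u * norm v)" using Cauchy_Schwarz_ineq2[of u v] by simp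
    also have "\<dots> \<le> (norm u)\<^sup>2 + (norm v)\<^sup>2"
      using zero_le_power2[of "norm u - norm v"] by (simp add: power2_diff)
    finally have "2 * \<bar>inner u v\<bar> \<le> (norm u)\<^sup>2 + (norm v)\<^sup>2" .
    moreover have "0 \<le> (norm u)\<^sup>2 + (norm v)\<^sup>2" by simp
    ultimately show ?thesis by linarith
  qed
  then show "AE \<omega> in M. norm (inner (f \<omega>) (g \<omega>)) \<le> norm ((norm (f \<omega>))\<^sup>2 + (norm (g \<omega>))\<^sup>2)"
    by simp
qed (use assms in \<open>auto simp: L2_iff\<close>)

lemma (in finite_measure) L2_const: "(\<lambda>_. c) \<in> Lp_rv M 2"
  by (simp add: L2_iff)

lemma (in finite_measure) L2_imp_integrable:
  fixes f :: "'a \<Rightarrow> 'h::{real_inner, banach, second_countable_topology}"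
  assumes "f \<in> Lp_rv M 2"
  shows "integrable M f"
proof (rule Bochner_Integration.integrable_bound)
  show "integrable M (\<lambda>\<omega>. 1 + (norm (f \<omega>))\<^sup>2)" using assms by (auto simp: L2_iff)
  have "norm u \<le> 1 + (norm u)\<^sup>2" for u :: 'h
  proof -
    have "0 \<le> (norm u - 1)\<^sup>2" by simp
    then have "2 * norm u \<le> (norm u)\<^sup>2 + 1" by (simp add: power2_diff)
    then show ?thesis using norm_ge_zero[of u] by linarith
  qed
  then show "AE \<omega> in M. norm (f \<omega>) \<le> norm (1 + (norm (f \<omega>))\<^sup>2)" by simp
qed (use assms in \<open>auto simp: L2_iff\<close>)

text \<open>Combines weak lower semicontinuity of the norm with Fatou's lemma.\<close>

lemma (in finite_measure) L2_Fatou: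
  fixes x :: "nat \<Rightarrow> 'a \<Rightarrow> 'h::{real_inner, second_countable_topology}"
  assumes x: "\<And>n. x n \<in> Lp_rv M 2" and C: "\<And>n. (LINT \<omega>|M. (norm (x n \<omega>))\<^sup>2) \<le> C"
    and l: "l \<in> borel_measurable M" and lim: "AE \<omega> in M. weakly_tendsto (\<lambda>n. x n \<omega>) (l \<omega>)"
  shows "l \<in> Lp_rv M 2"
proof -
  have xM: "x n \<in> borel_measurable M" for n using x[of n] by (simp add: L2_iff)
  have xi: "integrable M (\<lambda>\<omega>. (norm (x n \<omega>))\<^sup>2)" for n using x[of n] by (simp add: L2_iff)
  have "AE \<omega> in M. ennreal ((norm (l \<omega>))\<^sup>2) \<le> liminf (\<lambda>n. ennreal ((norm (x n \<omega>))\<^sup>2))"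
    using lim by eventually_elim (rule weak_lower_semicontinuity)
  then have "(\<integral>\<^sup>+\<omega>. ennreal ((norm (l \<omega>))\<^sup>2) \<partial>M) \<le> (\<integral>\<^sup>+\<omega>. liminf (\<lambda>n. ennreal ((norm (x n \<omega>))\<^sup>2)) \<partial>M)"
    by (rule nn_integral_mono_AE)
  also have "\<dots> \<le> liminf (\<lambda>n. \<integral>\<^sup>+\<omega>. ennreal ((norm (x n \<omega>))\<^sup>2) \<partial>M)"
    using xM by (intro nn_integral_liminf) auto
  also have "\<dots> \<le> limsup (\<lambda>n. \<integral>\<^sup>+\<omega>. ennreal ((norm (x n \<omega>))\<^sup>2) \<partial>M)"
    by (rule Liminf_le_Limsup) simp
  also have "\<dots> \<le> ennreal C"
    by (intro Limsup_bounded always_eventually allI)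
      (subst nn_integral_eq_integral[OF xi], auto intro: ennreal_leI C)
  finally have "(\<integral>\<^sup>+\<omega>. ennreal ((norm (l \<omega>))\<^sup>2) \<partial>M) < \<infinity>"
    by (rule le_less_trans) simp
  then show ?thesis
    using l unfolding L2_iff by (auto intro!: integrableI_bounded)
qed

text \<open>For \<open>v n = x n - l\<close>, the scalar products \<open>\<langle>v n, y\<rangle>\<close> tend to 0 almost surely but need not have an
  integrable majorant. Young's inequality bounds \<open>\<bar>\<langle>v n, y\<rangle>\<bar>\<close> by \<open>h + c \<parallel>v n\<parallel>\<^sup>2\<close> with \<open>h = \<parallel>y\<parallel>\<^sup>2 / c\<close>, hence by
  \<open>min \<bar>\<langle>v n, y\<rangle>\<bar> h + c \<parallel>v n\<parallel>\<^sup>2\<close>. The first term is dominated by \<open>h\<close>, and the expectation of the second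
  is small, uniformly in \<open>n\<close>, when \<open>c\<close> is small.\<close>

lemma (in finite_measure) weakly_tendsto_L2I:
  fixes x :: "nat \<Rightarrow> 'a \<Rightarrow> 'h::{real_inner, banach, second_countable_topology}"
  assumes x: "\<And>n. x n \<in> Lp_rv M 2" and C: "\<And>n. (LINT \<omega>|M. (norm (x n \<omega>))\<^sup>2) \<le> C"
    and l: "l \<in> borel_measurable M" and lim: "AE \<omega> in M. weakly_tendsto (\<lambda>n. x n \<omega>) (l \<omega>)"
  shows "weakly_tendsto_L2 M x l"
proof -
  have lL2: "l \<in> Lp_rv M 2" by (rule L2_Fatou[OF assms])
  have "(\<lambda>n. LINT \<omega>|M. inner (x n \<omega>) (y \<omega>)) \<longlonglongrightarrow> (LINT \<omega>|M. inner (l \<omega>) (y \<omega>))"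
    if y: "y \<in> Lp_rv M 2" for y
  proof (rule LIM_zero_cancel, rule tendstoI)
    fix e :: real assume e: "e > 0"
    define v where "v n \<omega> = x n \<omega> - l \<omega>" for n \<omega>
    define C' where "C' = 2 * C + 2 * (LINT \<omega>|M. (norm (l \<omega>))\<^sup>2)"
    have vL2: "v n \<in> Lp_rv M 2" for n using L2_diff[OF x lL2] by (simp add: v_def[abs_def])
    have vi: "integrable M (\<lambda>\<omega>. (norm (v n \<omega>))\<^sup>2)" for n using vL2[of n] by (simp add: L2_iff)
    have vC: "(LINT \<omega>|M. (norm (v n \<omega>))\<^sup>2) \<le> C'" for n
    proof -
      have "(LINT \<omega>|M. (norm (v n \<omega>))\<^sup>2)
          \<le> (LINT \<omega>|M. 2 * (norm (x n \<omega>))\<^sup>2 + 2 * (norm (l \<omega>))\<^sup>2)"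
        using x[of n] lL2 vi norm_add_squared_le[of "x n _" "- l _"]
        by (intro integral_mono) (auto simp: L2_iff v_def)
      also have "\<dots> = 2 * (LINT \<omega>|M. (norm (x n \<omega>))\<^sup>2) + 2 * (LINT \<omega>|M. (norm (l \<omega>))\<^sup>2)"
        using x[of n] lL2 by (subst Bochner_Integration.integral_add) (auto simp: L2_iff)
      finally show ?thesis using C[of n] by (simp add: C'_def)
    qed
    have "0 \<le> (LINT \<omega>|M. (norm (v 0 \<omega>))\<^sup>2)" by simp
    then have C'0: "0 \<le> C'" using vC[of 0] by linarith
    \<comment> \<open>Chosen so that the uniformly bounded part contributes less than \<open>e / 2\<close>.\<close>
    define c where "c = e / (2 * (C' + 1))"
    have c: "c > 0" "c * C' < e / 2" using e C'0 by (auto simp: c_def field_simps)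
    define h where "h \<omega> = (norm (y \<omega>))\<^sup>2 / c" for \<omega>
    define m where "m n \<omega> = min \<bar>inner (v n \<omega>) (y \<omega>)\<bar> (h \<omega>)" for n \<omega>
    have ip: "\<bar>inner (v n \<omega>) (y \<omega>)\<bar> \<le> m n \<omega> + c * (norm (v n \<omega>))\<^sup>2" for n \<omega>
    proof -
      have "0 \<le> (c * norm (v n \<omega>) - norm (y \<omega>))\<^sup>2" by simp
      then have "2 * (c * (norm (v n \<omega>) * norm (y \<omega>))) \<le> c * (c * (norm (v n \<omega>))\<^sup>2) + (norm (y \<omega>))\<^sup>2"
        by (simp add: power2_diff power_mult_distrib power2_eq_square algebra_simps)
      then have "2 * (norm (v n \<omega>) * norm (y \<omega>)) \<le> c * (norm (v n \<omega>))\<^sup>2 + h \<omega>"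
        using c(1) by (simp add: h_def field_simps)
      moreover have "0 \<le> norm (v n \<omega>) * norm (y \<omega>)" by simp
      ultimately have "\<bar>inner (v n \<omega>) (y \<omega>)\<bar> \<le> h \<omega> + c * (norm (v n \<omega>))\<^sup>2"
        using Cauchy_Schwarz_ineq2[of "v n \<omega>" "y \<omega>"] by linarith
      moreover have "0 \<le> c * (norm (v n \<omega>))\<^sup>2" using c by simp
      ultimately show ?thesis by (simp add: m_def min_def)
    qed
    have hi: "integrable M h" using y by (simp add: L2_iff h_def[abs_def])
    have h0: "0 \<le> h \<omega>" for \<omega> using c by (simp add: h_def)
    have inn: "integrable M (\<lambda>\<omega>. inner (v n \<omega>) (y \<omega>))" for n by (rule L2_inner[OF vL2 y])
    have mi: "integrable M (m n)" for n
      unfolding m_def[abs_def] by (intro integrable_min integrable_abs inn hi)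
    have "(\<lambda>n. LINT \<omega>|M. m n \<omega>) \<longlonglongrightarrow> (LINT \<omega>|M. 0)"
    proof (rule integral_dominated_convergence)
      show "AE \<omega> in M. (\<lambda>n. m n \<omega>) \<longlonglongrightarrow> 0"
        using lim
      proof eventually_elim
        fix \<omega> assume "weakly_tendsto (\<lambda>n. x n \<omega>) (l \<omega>)"
        then have "(\<lambda>n. inner (x n \<omega>) (y \<omega>) - inner (l \<omega>) (y \<omega>)) \<longlonglongrightarrow> 0"
          unfolding weakly_tendsto_def by (intro LIM_zero) blast
        then have "(\<lambda>n. min \<bar>inner (v n \<omega>) (y \<omega>)\<bar> (h \<omega>)) \<longlonglongrightarrow> min \<bar>0\<bar> (h \<omega>)"
          unfolding v_def inner_diff_left by (intro tendsto_min tendsto_rabs tendsto_const)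
        then show "(\<lambda>n. m n \<omega>) \<longlonglongrightarrow> 0" using h0[of \<omega>] by (simp add: m_def)
      qed
      show "AE \<omega> in M. norm (m n \<omega>) \<le> h \<omega>" for n using h0 by (simp add: m_def)
    qed (use mi hi in auto)
    then have "\<forall>\<^sub>F n in sequentially. (LINT \<omega>|M. m n \<omega>) < e / 2"
      using order_tendstoD(2)[of _ 0 sequentially "e / 2"] e by simp
    then show "\<forall>\<^sub>F n in sequentially.
        dist ((LINT \<omega>|M. inner (x n \<omega>) (y \<omega>)) - (LINT \<omega>|M. inner (l \<omega>) (y \<omega>))) 0 < e"
    proof eventually_elim
      case (elim n)
      have "(LINT \<omega>|M. inner (x n \<omega>) (y \<omega>)) - (LINT \<omega>|M. inner (l \<omega>) (y \<omega>))
          = (LINT \<omega>|M. inner (v n \<omega>) (y \<omega>))"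
        using L2_inner[OF x y] L2_inner[OF lL2 y]
        by (simp add: v_def inner_diff_left Bochner_Integration.integral_diff)
      moreover have "\<bar>LINT \<omega>|M. inner (v n \<omega>) (y \<omega>)\<bar> \<le> (LINT \<omega>|M. \<bar>inner (v n \<omega>) (y \<omega>)\<bar>)"
        by (rule integral_abs_bound)
      moreover have "(LINT \<omega>|M. \<bar>inner (v n \<omega>) (y \<omega>)\<bar>) \<le> (LINT \<omega>|M. m n \<omega> + c * (norm (v n \<omega>))\<^sup>2)"
        using ip mi vi inn by (intro integral_mono) auto
      moreover have "(LINT \<omega>|M. m n \<omega> + c * (norm (v n \<omega>))\<^sup>2)
          = (LINT \<omega>|M. m n \<omega>) + c * (LINT \<omega>|M. (norm (v n \<omega>))\<^sup>2)"
        using mi vi by (subst Bochner_Integration.integral_add) auto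
      moreover have "c * (LINT \<omega>|M. (norm (v n \<omega>))\<^sup>2) \<le> c * C'"
        using vC c by (intro mult_left_mono) auto
      ultimately show ?case using elim c(2) unfolding dist_real_def by linarith
    qed
  qed
  then show ?thesis using x lL2 by (simp add: weakly_tendsto_L2_def)
qed

section \<open>One step of the stochastic projection algorithm\<close>

text \<open>If \<open>t \<noteq> 0\<close> and \<open>x\<close> violates \<open>\<langle>x, t\<rangle> \<le> \<eta>\<close>, then \<open>\<alpha> t\<close> is the displacement from the projection of \<open>x\<close> onto that
  half-space to \<open>x\<close>; otherwise \<open>\<alpha> = 0\<close>. The first identity says that the projected point \<open>x - \<alpha> t\<close> lies
  on the bounding hyperplane. The other two give the integrability: the displacement is square-integrable if \<open>x\<close> and
  \<open>q\<close> are, and then \<open>\<alpha> \<eta>\<close> is a product of two square-integrable variables.\<close>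

lemma relaxation_cutoff_identities:
  fixes x t :: "'h::real_inner" and \<eta> \<alpha> q :: real
  assumes \<alpha>: "\<alpha> = of_bool (t \<noteq> 0) * of_bool (inner x t > \<eta>) * (inner x t - \<eta>)
      / ((norm t)\<^sup>2 + of_bool (t = 0))"
    and q: "q = of_bool (t \<noteq> 0) * of_bool (inner x t > \<eta>) * \<eta> / (norm t + of_bool (t = 0))"
  shows "inner x (\<alpha> *\<^sub>R t) = (norm (\<alpha> *\<^sub>R t))\<^sup>2 + \<alpha> * \<eta>"
    and "norm (\<alpha> *\<^sub>R t) \<le> norm x + \<bar>q\<bar>"
    and "\<alpha> * \<eta> = norm (\<alpha> *\<^sub>R t) * q"
proof -
  have "inner x (\<alpha> *\<^sub>R t) = (norm (\<alpha> *\<^sub>R t))\<^sup>2 + \<alpha> * \<eta> \<and> norm (\<alpha> *\<^sub>R t) \<le> norm x + \<bar>q\<bar>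
      \<and> \<alpha> * \<eta> = norm (\<alpha> *\<^sub>R t) * q"
  proof (cases "t \<noteq> 0 \<and> inner x t > \<eta>")
    case True
    then have t: "norm t > 0" by simp
    have a: "\<alpha> = (inner x t - \<eta>) / (norm t)\<^sup>2" and q': "q = \<eta> / norm t" using True \<alpha> q by auto
    have n: "norm (\<alpha> *\<^sub>R t) = (inner x t - \<eta>) / norm t"
      using True t by (simp add: a power2_eq_square)
    have "inner x t / norm t \<le> norm x"
      using t norm_cauchy_schwarz[of x t] by (simp add: divide_le_eq)
    moreover have "- (\<eta> / norm t) \<le> \<bar>q\<bar>" unfolding q' by linarith
    ultimately have "norm (\<alpha> *\<^sub>R t) \<le> norm x + \<bar>q\<bar>" unfolding n diff_divide_distrib by linarith
    moreover have "inner x (\<alpha> *\<^sub>R t) = (norm (\<alpha> *\<^sub>R t))\<^sup>2 + \<alpha> * \<eta>"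
      using t unfolding n a by (simp add: power_divide power2_eq_square field_simps)
    moreover have "\<alpha> * \<eta> = norm (\<alpha> *\<^sub>R t) * q"
      using t unfolding n by (simp add: a q' power2_eq_square)
    ultimately show ?thesis by blast
  qed (auto simp: \<alpha> q)
  then show "inner x (\<alpha> *\<^sub>R t) = (norm (\<alpha> *\<^sub>R t))\<^sup>2 + \<alpha> * \<eta>"
    and "norm (\<alpha> *\<^sub>R t) \<le> norm x + \<bar>q\<bar>" and "\<alpha> * \<eta> = norm (\<alpha> *\<^sub>R t) * q" by auto
qed

context prob_space
begin

text \<open>Expanding the square and using \<open>\<langle>x, d\<rangle> = \<parallel>d\<parallel>\<^sup>2 + g\<close>,
  \<open>\<parallel>x' - z\<parallel>\<^sup>2 = \<parallel>x - z\<parallel>\<^sup>2 + 2 \<mu> (\<langle>d, z\<rangle> - g) - \<mu> (2 - \<mu>) \<parallel>d\<parallel>\<^sup>2\<close>, whose last term helps since \<open>0 \<le> \<mu> \<le> 2\<close>.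
  As \<open>\<mu>\<close> is \<open>F\<close>-measurable, averaging over events of \<open>F\<close> replaces \<open>\<langle>d, z\<rangle> - g\<close> by its conditional
  expectation, and the positive part makes the drift nonnegative.\<close>

lemma relaxed_step_expectation:
  fixes x x' d :: "'a \<Rightarrow> 'h::{real_inner, banach, second_countable_topology}" and z :: 'h
  assumes F: "subalgebra M F" and x: "x \<in> Lp_rv M 2" and d: "d \<in> Lp_rv M 2"
    and g: "integrable M g" and xd: "\<And>\<omega>. \<omega> \<in> space M \<Longrightarrow> inner (x \<omega>) (d \<omega>) = (norm (d \<omega>))\<^sup>2 + g \<omega>"
    and \<mu>[measurable]: "\<mu> \<in> borel_measurable F" and \<mu>02: "\<And>\<omega>. 0 \<le> \<mu> \<omega>" "\<And>\<omega>. \<mu> \<omega> \<le> 2"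
    and x': "x' \<in> borel_measurable M" "AE \<omega> in M. x' \<omega> = x \<omega> - \<mu> \<omega> *\<^sub>R d \<omega>"
  defines "b \<equiv> \<lambda>\<omega>. 2 * \<mu> \<omega> * max 0 (inner z (vec_cond_exp M F d \<omega>) - real_cond_exp M F g \<omega>)"
  shows "b \<in> borel_measurable F" and "integrable M b"
    and "A \<in> sets F \<Longrightarrow> (LINT \<omega>:A|M. (norm (x' \<omega> - z))\<^sup>2)
        \<le> (LINT \<omega>:A|M. (norm (x \<omega> - z))\<^sup>2) + (LINT \<omega>:A|M. b \<omega>)"
proof -
  interpret sigma_finite_subalgebra M F by (rule sigma_finite_subalgebra_of_prob[OF F])
  have di: "integrable M d" by (rule L2_imp_integrable[OF d])
  note ce = is_cond_exp_vec_cond_exp[OF F di]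
  define \<zeta> where "\<zeta> \<omega> = inner (d \<omega>) z - g \<omega>" for \<omega>
  define \<beta> where "\<beta> \<omega> = inner z (vec_cond_exp M F d \<omega>) - real_cond_exp M F g \<omega>" for \<omega>
  have vm[measurable]: "vec_cond_exp M F d \<in> borel_measurable F" and vi: "integrable M (vec_cond_exp M F d)"
    using ce by (auto simp: is_cond_exp_def)
  have \<mu>M[measurable]: "\<mu> \<in> borel_measurable M" by (rule measurable_from_subalg[OF F \<mu>])
  show bF: "b \<in> borel_measurable F" unfolding b_def by measurable
  have \<beta>i: "integrable M \<beta>"
    unfolding \<beta>_def[abs_def] using vi real_cond_exp_int(1)[OF g] by auto
  have \<mu>_int: "integrable M (\<lambda>\<omega>. \<mu> \<omega> * f \<omega>)" if f: "integrable M f" for f :: "'a \<Rightarrow> real"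
  proof (rule Bochner_Integration.integrable_bound)
    show "integrable M (\<lambda>\<omega>. 2 * f \<omega>)" using f by simp
    show "AE \<omega> in M. norm (\<mu> \<omega> * f \<omega>) \<le> norm (2 * f \<omega>)"
      using \<mu>02 by (intro AE_I2) (simp add: abs_mult mult_right_mono)
  qed (use f in measurable)
  have b_eq: "b \<omega> = 2 * (\<mu> \<omega> * max 0 (\<beta> \<omega>))" for \<omega> by (simp add: b_def \<beta>_def)
  have mx: "integrable M (\<lambda>\<omega>. \<mu> \<omega> * max 0 (\<beta> \<omega>))" by (intro \<mu>_int integrable_max \<beta>i) simp
  then show bi: "integrable M b" unfolding b_eq[abs_def] by simp
  have \<zeta>i: "integrable M \<zeta>" unfolding \<zeta>_def[abs_def] using di g by auto
  have \<zeta>\<beta>: "AE \<omega> in M. real_cond_exp M F \<zeta> \<omega> = \<beta> \<omega>"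
  proof -
    have "AE \<omega> in M. real_cond_exp M F \<zeta> \<omega>
        = real_cond_exp M F (\<lambda>\<omega>. inner (d \<omega>) z) \<omega> - real_cond_exp M F g \<omega>"
      unfolding \<zeta>_def[abs_def] using di g by (intro real_cond_exp_diff) auto
    with is_cond_exp_inner[OF F di ce, of z] show ?thesis
      by eventually_elim (simp add: \<beta>_def inner_commute)
  qed
  have norm_int: "integrable M (\<lambda>\<omega>. (norm (x \<omega> - z))\<^sup>2)"
    using L2_diff[OF x L2_const] by (simp add: L2_iff)
  have norm_le: "AE \<omega> in M. (norm (x' \<omega> - z))\<^sup>2 \<le> (norm (x \<omega> - z))\<^sup>2 + 2 * (\<mu> \<omega> * \<zeta> \<omega>)"
    using x'(2)
  proof (rule AE_mp, intro AE_I2 impI)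
    fix \<omega> assume \<omega>: "\<omega> \<in> space M" and eq: "x' \<omega> = x \<omega> - \<mu> \<omega> *\<^sub>R d \<omega>"
    have "(norm (x' \<omega> - z))\<^sup>2 = (norm (x \<omega> - z))\<^sup>2
        - 2 * \<mu> \<omega> * (inner (x \<omega>) (d \<omega>) - inner (d \<omega>) z) + (\<mu> \<omega>)\<^sup>2 * (norm (d \<omega>))\<^sup>2"
      unfolding eq power2_norm_eq_inner by (simp add: inner_simps inner_commute power2_eq_square algebra_simps)
    also have "\<dots> = (norm (x \<omega> - z))\<^sup>2 + 2 * (\<mu> \<omega> * \<zeta> \<omega>) - \<mu> \<omega> * (2 - \<mu> \<omega>) * (norm (d \<omega>))\<^sup>2"
      unfolding xd[OF \<omega>] \<zeta>_def by (simp add: power2_eq_square algebra_simps)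
    also have "\<dots> \<le> (norm (x \<omega> - z))\<^sup>2 + 2 * (\<mu> \<omega> * \<zeta> \<omega>)"
      using \<mu>02[of \<omega>] by simp
    finally show "(norm (x' \<omega> - z))\<^sup>2 \<le> (norm (x \<omega> - z))\<^sup>2 + 2 * (\<mu> \<omega> * \<zeta> \<omega>)" .
  qed
  assume A: "A \<in> sets F"
  then have AM[measurable]: "A \<in> sets M" using F by (auto simp: subalgebra_def)
  have ind: "integrable M (\<lambda>\<omega>. indicator A \<omega> * f \<omega>)" if "integrable M f" for f :: "'a \<Rightarrow> real"
    using integrable_mult_indicator[OF AM that] by simp
  have up_int: "integrable M (\<lambda>\<omega>. (norm (x \<omega> - z))\<^sup>2 + 2 * (\<mu> \<omega> * \<zeta> \<omega>))"
    using norm_int \<mu>_int[OF \<zeta>i] by simp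
  have "(LINT \<omega>:A|M. (norm (x' \<omega> - z))\<^sup>2)
      \<le> (LINT \<omega>|M. indicator A \<omega> * ((norm (x \<omega> - z))\<^sup>2 + 2 * (\<mu> \<omega> * \<zeta> \<omega>)))"
    unfolding set_lebesgue_integral_def real_scaleR_def
  proof (rule integral_mono_AE)
    have "integrable M (\<lambda>\<omega>. (norm (x' \<omega> - z))\<^sup>2)"
    proof (rule Bochner_Integration.integrable_bound[OF up_int])
      show "AE \<omega> in M. norm ((norm (x' \<omega> - z))\<^sup>2) \<le> norm ((norm (x \<omega> - z))\<^sup>2 + 2 * (\<mu> \<omega> * \<zeta> \<omega>))"
        using norm_le by eventually_elim (simp add: abs_if)
    qed (use x'(1) in measurable)
    then show "integrable M (\<lambda>\<omega>. indicator A \<omega> * (norm (x' \<omega> - z))\<^sup>2)" by (rule ind)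
    show "AE \<omega> in M. indicator A \<omega> * (norm (x' \<omega> - z))\<^sup>2
        \<le> indicator A \<omega> * ((norm (x \<omega> - z))\<^sup>2 + 2 * (\<mu> \<omega> * \<zeta> \<omega>))"
      using norm_le by eventually_elim (auto intro: mult_left_mono)
  qed (rule ind[OF up_int])
  also have "\<dots> = (LINT \<omega>:A|M. (norm (x \<omega> - z))\<^sup>2) + 2 * (LINT \<omega>|M. indicator A \<omega> * (\<mu> \<omega> * \<zeta> \<omega>))"
    unfolding set_lebesgue_integral_def real_scaleR_def
    using ind[OF norm_int] ind[OF \<mu>_int[OF \<zeta>i]]
    by (simp add: distrib_left Bochner_Integration.integral_add mult.left_commute[of _ 2])
  also have "(LINT \<omega>|M. indicator A \<omega> * (\<mu> \<omega> * \<zeta> \<omega>)) = (LINT \<omega>|M. (indicator A \<omega> * \<mu> \<omega>) * real_cond_exp M F \<zeta> \<omega>)"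
  proof -
    have "(\<lambda>\<omega>. indicator A \<omega> * \<mu> \<omega>) \<in> borel_measurable F" using A by measurable
    moreover have "integrable M (\<lambda>\<omega>. (indicator A \<omega> * \<mu> \<omega>) * \<zeta> \<omega>)"
      using ind[OF \<mu>_int[OF \<zeta>i]] by (simp add: mult.assoc)
    ultimately show ?thesis
      using real_cond_exp_intg(2)[of "\<lambda>\<omega>. indicator A \<omega> * \<mu> \<omega>" \<zeta>] \<zeta>i by (simp add: mult.assoc)
  qed
  also have "(LINT \<omega>|M. (indicator A \<omega> * \<mu> \<omega>) * real_cond_exp M F \<zeta> \<omega>)
      = (LINT \<omega>|M. indicator A \<omega> * (\<mu> \<omega> * \<beta> \<omega>))"
    by (rule integral_cong_AE) (use \<zeta>\<beta> \<beta>i in \<open>auto simp: mult.assoc elim!: eventually_mono\<close>)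
  also have "\<dots> \<le> (LINT \<omega>|M. indicator A \<omega> * (\<mu> \<omega> * max 0 (\<beta> \<omega>)))"
    using \<mu>02 by (intro integral_mono ind \<mu>_int \<beta>i mx mult_left_mono) auto
  also have "2 * (LINT \<omega>|M. indicator A \<omega> * (\<mu> \<omega> * max 0 (\<beta> \<omega>))) = (LINT \<omega>:A|M. b \<omega>)"
    unfolding set_lebesgue_integral_def b_eq by (simp add: mult.left_commute[of _ 2])
  finally show "(LINT \<omega>:A|M. (norm (x' \<omega> - z))\<^sup>2)
        \<le> (LINT \<omega>:A|M. (norm (x \<omega> - z))\<^sup>2) + (LINT \<omega>:A|M. b \<omega>)" by simp
qed

end

lemma sigma_rvs_simps:
  shows space_sigma_rvs: "space (sigma_rvs M x n) = space M"
    and sets_sigma_rvs: "sets (sigma_rvs M x n)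
      = sigma_sets (space M) (\<Union>i\<le>n. {x i -` A \<inter> space M | A. A \<in> sets borel})"
proof -
  have G: "(\<Union>i\<le>n. {x i -` A \<inter> space M | A. A \<in> sets borel}) \<subseteq> Pow (space M)" by auto
  show "space (sigma_rvs M x n) = space M"
    unfolding sigma_rvs_def by (rule space_measure_of[OF G])
  show "sets (sigma_rvs M x n)
      = sigma_sets (space M) (\<Union>i\<le>n. {x i -` A \<inter> space M | A. A \<in> sets borel})"
    unfolding sigma_rvs_def by (rule sets_measure_of[OF G])
qed

text \<open>Stated for a single \<open>n\<close>: in the induction that shows the iterates to be measurable, only
  \<open>x 0, \<dots>, x n\<close> are known to be so when this is applied.\<close>

lemma subalgebra_sigma_rvs:
  assumes "\<And>k. k \<le> n \<Longrightarrow> x k \<in> borel_measurable M"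
  shows "subalgebra M (sigma_rvs M x n)"
proof -
  have "(\<Union>i\<le>n. {x i -` A \<inter> space M | A. A \<in> sets borel}) \<subseteq> sets M"
    using assms by (auto intro: measurable_sets)
  then show ?thesis
    unfolding subalgebra_def sigma_rvs_simps by (simp add: sets.sigma_sets_subset)
qed

lemma sigma_rvs_mono: "m \<le> n \<Longrightarrow> sets (sigma_rvs M x m) \<subseteq> sets (sigma_rvs M x n)"
  unfolding sigma_rvs_simps by (intro sigma_sets_mono') force

lemma measurable_sigma_rvs: "k \<le> n \<Longrightarrow> x k \<in> borel_measurable (sigma_rvs M x n)"
  by (rule measurableI) (auto simp: sigma_rvs_simps)

section \<open>Weak convergence of the iterates\<close>

theorem theorem3p9:
  fixes M :: "'a measure"
    and Z :: "'h::{real_inner, banach, second_countable_topology} set"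
    and x t d :: "nat \<Rightarrow> 'a \<Rightarrow> 'h"
    and \<eta> \<alpha> lam :: "nat \<Rightarrow> 'a \<Rightarrow> real"
    and \<epsilon> :: "nat \<Rightarrow> 'a \<Rightarrow> 'h \<Rightarrow> real"
    and \<X> :: "nat \<Rightarrow> 'a measure"
  assumes "prob_space M" and "complete_measure M"
    and "closed Z" and "Z \<noteq> {}"
    and "x 0 \<in> Lp_rv M 2"
    and "\<And>n. \<X> n = sigma_rvs M x n"
    and "\<And>n. t n \<in> Lp_rv M 2"
    and "\<And>n. \<eta> n \<in> Lp_rv M 1"
    and "\<And>n. \<epsilon> n \<in> caratheodory_class M"
    and "\<And>n. (\<lambda>\<omega>. of_bool (t n \<omega> \<noteq> 0) * of_bool (inner (x n \<omega>) (t n \<omega>) > \<eta> n \<omega>) * \<eta> n \<omega>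
                / (norm (t n \<omega>) + of_bool (t n \<omega> = 0))) \<in> Lp_rv M 2"
    and "\<And>n \<omega>. \<alpha> n \<omega> =
           of_bool (t n \<omega> \<noteq> 0) * of_bool (inner (x n \<omega>) (t n \<omega>) > \<eta> n \<omega>)
             * (inner (x n \<omega>) (t n \<omega>) - \<eta> n \<omega>)
             / ((norm (t n \<omega>))\<^sup>2 + of_bool (t n \<omega> = 0))"
    and "\<And>n z. z \<in> Z \<Longrightarrow> AE \<omega> in M.
           inner z (vec_cond_exp M (\<X> n) (\<lambda>\<omega>. \<alpha> n \<omega> *\<^sub>R t n \<omega>) \<omega>)
             \<le> real_cond_exp M (\<X> n) (\<lambda>\<omega>. \<alpha> n \<omega> * \<eta> n \<omega>) \<omega> + \<epsilon> n \<omega> z"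
    and "\<And>n \<omega>. d n \<omega> = \<alpha> n \<omega> *\<^sub>R t n \<omega>"
    and "\<And>n. lam n \<in> Linf_rv M (\<X> n) {0<..<2}"
    and "\<And>n. AE \<omega> in M. x (Suc n) \<omega> = x n \<omega> - lam n \<omega> *\<^sub>R d n \<omega>"
    and "\<And>z. z \<in> Z \<Longrightarrow> AE \<omega> in M. summable (\<lambda>n. lam n \<omega> * \<epsilon> n \<omega> z)"
    and "AE \<omega> in M. weak_cluster_points (\<lambda>n. x n \<omega>) \<subseteq> Z"
  shows "\<exists>x'. x' \<in> borel_measurable M \<and> (\<forall>\<omega>\<in>space M. x' \<omega> \<in> Z) \<and>
           (AE \<omega> in M. weakly_tendsto (\<lambda>n. x n \<omega>) (x' \<omega>)) \<and>
           ((\<forall>z\<in>Z. summable (\<lambda>n. LINT \<omega>|M. lam n \<omega> * \<epsilon> n \<omega> z)) \<longrightarrow>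
              x' \<in> Lp_rv M 2 \<and> weakly_tendsto_L2 M x x')"
proof -
  interpret prob_space M by fact
  interpret complete_measure M by fact
  note ineq = assms(12) and x_Suc = assms(15) and cluster = assms(17)
  have X: "\<X> n = sigma_rvs M x n" and d: "d n \<omega> = \<alpha> n \<omega> *\<^sub>R t n \<omega>" for n \<omega> by fact+
  define q where "q n \<omega> = of_bool (t n \<omega> \<noteq> 0) * of_bool (inner (x n \<omega>) (t n \<omega>) > \<eta> n \<omega>) * \<eta> n \<omega>
      / (norm (t n \<omega>) + of_bool (t n \<omega> = 0))" for n \<omega>
  have qL2: "q n \<in> Lp_rv M 2" for n unfolding q_def[abs_def] by fact
  note cutoff = relaxation_cutoff_identities[OF assms(11) q_def, folded d]
  have tM[measurable]: "t n \<in> borel_measurable M" for n using assms(7)[of n] by (simp add: L2_iff)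
  have \<eta>M[measurable]: "\<eta> n \<in> borel_measurable M" for n using assms(8)[of n] by (simp add: Lp_rv_def)
  have \<alpha>_if: "\<alpha> n = (\<lambda>\<omega>. if t n \<omega> \<noteq> 0 \<and> \<eta> n \<omega> < inner (x n \<omega>) (t n \<omega>)
      then (inner (x n \<omega>) (t n \<omega>) - \<eta> n \<omega>) / (norm (t n \<omega>))\<^sup>2 else 0)" for n
    by (auto simp: assms(11))
  have \<alpha>M: "\<alpha> n \<in> borel_measurable M" if [measurable]: "x n \<in> borel_measurable M" for n
    unfolding \<alpha>_if by measurable
  have dL2_of: "d n \<in> Lp_rv M 2" if xL2: "x n \<in> Lp_rv M 2" for n
  proof (rule L2_bound)
    have [measurable]: "\<alpha> n \<in> borel_measurable M" using xL2 by (intro \<alpha>M) (simp add: L2_iff)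
    show "d n \<in> borel_measurable M" unfolding d[abs_def] by measurable
    show "integrable M (\<lambda>\<omega>. 2 * (norm (x n \<omega>))\<^sup>2 + 2 * (norm (q n \<omega>))\<^sup>2)"
      using xL2 qL2[of n] by (auto simp: L2_iff)
    show "AE \<omega> in M. (norm (d n \<omega>))\<^sup>2 \<le> 2 * (norm (x n \<omega>))\<^sup>2 + 2 * (norm (q n \<omega>))\<^sup>2"
    proof (rule AE_I2)
      fix \<omega>
      have "(norm (d n \<omega>))\<^sup>2 \<le> (norm (norm (x n \<omega>) + \<bar>q n \<omega>\<bar>))\<^sup>2"
        using cutoff(2)[of n \<omega>] by (intro power_mono) auto
      also have "\<dots> \<le> 2 * (norm (x n \<omega>))\<^sup>2 + 2 * (norm (q n \<omega>))\<^sup>2"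
        using norm_add_squared_le[of "norm (x n \<omega>)" "\<bar>q n \<omega>\<bar>"] by simp
      finally show "(norm (d n \<omega>))\<^sup>2 \<le> 2 * (norm (x n \<omega>))\<^sup>2 + 2 * (norm (q n \<omega>))\<^sup>2" .
    qed
  qed
  \<comment> \<open>Truncation makes the bounds on the relaxation parameters hold everywhere instead of almost surely.\<close>
  define \<mu> where "\<mu> n \<omega> = max 0 (min 2 (lam n \<omega>))" for n \<omega>
  have \<mu>02: "0 \<le> \<mu> n \<omega>" "\<mu> n \<omega> \<le> 2" for n \<omega> by (auto simp: \<mu>_def)
  have lamX[measurable]: "lam n \<in> borel_measurable (\<X> n)" for n using assms(14)[of n] by (simp add: Linf_rv_def)
  have \<mu>X: "\<mu> n \<in> borel_measurable (\<X> n)" for n unfolding \<mu>_def[abs_def] by measurable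
  have \<mu>_lam: "AE \<omega> in M. \<mu> n \<omega> = lam n \<omega>" for n
  proof -
    have "AE \<omega> in M. lam n \<omega> \<in> {0<..<2}" using assms(14)[of n] by (simp add: Linf_rv_def)
    then show ?thesis by eventually_elim (auto simp: \<mu>_def)
  qed
  have x_Suc': "AE \<omega> in M. x n \<omega> - \<mu> n \<omega> *\<^sub>R d n \<omega> = x (Suc n) \<omega>" for n
    using x_Suc[of n] \<mu>_lam[of n] by eventually_elim simp
  \<comment> \<open>Measurability of \<open>lam m\<close> in \<open>M\<close> needs the sub-sigma-algebra property of \<open>\<X> m\<close>, hence measurability of
    all earlier iterates: the induction is course-of-values. Completeness transfers measurability along
    the almost sure recursion.\<close>
  have xL2: "x n \<in> Lp_rv M 2" for n
  proof (induction n rule: less_induct)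
    case (less n)
    show ?case
    proof (cases n)
      case 0
      then show ?thesis using assms(5) by simp
    next
      case (Suc m)
      have xm: "x m \<in> Lp_rv M 2" using less Suc by simp
      note dm = dL2_of[OF xm]
      have [measurable]: "x m \<in> borel_measurable M" "d m \<in> borel_measurable M"
        using xm dm by (auto simp: L2_iff)
      have "subalgebra M (\<X> m)"
        unfolding X using less Suc by (intro subalgebra_sigma_rvs) (auto simp: L2_iff)
      then have [measurable]: "\<mu> m \<in> borel_measurable M" using \<mu>X by (rule measurable_from_subalg)
      have "(\<lambda>\<omega>. x m \<omega> - \<mu> m \<omega> *\<^sub>R d m \<omega>) \<in> Lp_rv M 2"
      proof (rule L2_bound)
        show "AE \<omega> in M. (norm (x m \<omega> - \<mu> m \<omega> *\<^sub>R d m \<omega>))\<^sup>2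
            \<le> 2 * (norm (x m \<omega>))\<^sup>2 + 8 * (norm (d m \<omega>))\<^sup>2"
        proof (rule AE_I2)
          fix \<omega>
          have "(\<mu> m \<omega>)\<^sup>2 \<le> 2\<^sup>2" using \<mu>02[of m \<omega>] by (intro power_mono) auto
          then have "(\<mu> m \<omega>)\<^sup>2 * (norm (d m \<omega>))\<^sup>2 \<le> 4 * (norm (d m \<omega>))\<^sup>2"
            by (intro mult_right_mono) auto
          then show "(norm (x m \<omega> - \<mu> m \<omega> *\<^sub>R d m \<omega>))\<^sup>2 \<le> 2 * (norm (x m \<omega>))\<^sup>2 + 8 * (norm (d m \<omega>))\<^sup>2"
            using norm_add_squared_le[of "x m \<omega>" "- (\<mu> m \<omega> *\<^sub>R d m \<omega>)"] by (simp add: power_mult_distrib)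
        qed
      qed (use xm dm in \<open>auto simp: L2_iff\<close>)
      then have I: "(\<lambda>\<omega>. x m \<omega> - \<mu> m \<omega> *\<^sub>R d m \<omega>) \<in> borel_measurable M"
        "integrable M (\<lambda>\<omega>. (norm (x m \<omega> - \<mu> m \<omega> *\<^sub>R d m \<omega>))\<^sup>2)"
        by (auto simp: L2_iff)
      have xSM: "x (Suc m) \<in> borel_measurable M"
        by (rule measurable_AE_eq[OF I(1) x_Suc']) simp
      moreover have "AE \<omega> in M. (norm (x (Suc m) \<omega>))\<^sup>2 \<le> (norm (x m \<omega> - \<mu> m \<omega> *\<^sub>R d m \<omega>))\<^sup>2"
        using x_Suc'[of m] by eventually_elim simp
      ultimately show ?thesis unfolding Suc by (intro L2_bound[OF _ I(2)])
    qed
  qed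
  have xM[measurable]: "x n \<in> borel_measurable M" for n using xL2[of n] by (simp add: L2_iff)
  have dL2: "d n \<in> Lp_rv M 2" for n by (rule dL2_of[OF xL2])
  have sub: "subalgebra M (\<X> n)" for n unfolding X by (rule subalgebra_sigma_rvs) (rule xM)
  have \<mu>M[measurable]: "\<mu> n \<in> borel_measurable M" for n by (rule measurable_from_subalg[OF sub \<mu>X])
  have \<alpha>\<eta>: "integrable M (\<lambda>\<omega>. \<alpha> n \<omega> * \<eta> n \<omega>)" for n
  proof -
    have "(\<lambda>\<omega>. norm (d n \<omega>)) \<in> Lp_rv M 2" using dL2[of n] by (auto simp: L2_iff)
    from L2_inner[OF this qL2[of n]] show ?thesis by (simp add: cutoff(3))
  qed
  \<comment> \<open>The drift is built from the conditional expectations, not from \<open>\<epsilon> n\<close>: it is \<open>\<X> n\<close>-measurable and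
    dominated by \<open>2 lam n \<epsilon> n\<close>.\<close>
  define b where "b z n = (\<lambda>\<omega>. 2 * \<mu> n \<omega> * max 0 (inner z (vec_cond_exp M (\<X> n) (d n) \<omega>)
      - real_cond_exp M (\<X> n) (\<lambda>\<omega>. \<alpha> n \<omega> * \<eta> n \<omega>) \<omega>))" for z n
  have b0: "0 \<le> b z n \<omega>" for z n \<omega> using \<mu>02 by (simp add: b_def)
  have qs: "quasi_supermartingale M \<X> (\<lambda>n \<omega>. (norm (x n \<omega> - z))\<^sup>2) (b z)" for z
  proof unfold_locales
    fix n
    show "subalgebra M (\<X> n)" by (rule sub)
    show "sets (\<X> m) \<subseteq> sets (\<X> n)" if "m \<le> n" for m unfolding X by (rule sigma_rvs_mono[OF that])
    have [measurable]: "x n \<in> borel_measurable (\<X> n)" unfolding X by (rule measurable_sigma_rvs) simp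
    show "(\<lambda>\<omega>. (norm (x n \<omega> - z))\<^sup>2) \<in> borel_measurable (\<X> n)" by measurable
    show "integrable M (\<lambda>\<omega>. (norm (x n \<omega> - z))\<^sup>2)"
      using L2_diff[OF xL2 L2_const] by (simp add: L2_iff)
    have "AE \<omega> in M. x (Suc n) \<omega> = x n \<omega> - \<mu> n \<omega> *\<^sub>R d n \<omega>"
      using x_Suc'[of n] by eventually_elim simp
    note step = relaxed_step_expectation[OF sub[of n] xL2[of n] dL2[of n] \<alpha>\<eta>[of n] cutoff(1)
        \<mu>X[of n] \<mu>02[of n] xM[of "Suc n"] this, where z = z, folded b_def]
    show "b z n \<in> borel_measurable (\<X> n)" "integrable M (b z n)"
      by (rule step(1) step(2))+
    show "(LINT \<omega>:A|M. (norm (x (Suc n) \<omega> - z))\<^sup>2)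
        \<le> (LINT \<omega>:A|M. (norm (x n \<omega> - z))\<^sup>2) + (LINT \<omega>:A|M. b z n \<omega>)" if "A \<in> sets (\<X> n)" for A
      by (rule step(3)[OF that])
    show "0 \<le> b z n \<omega>" for \<omega> by (rule b0)
  qed auto
  have \<epsilon>0: "0 \<le> \<epsilon> n \<omega> z" if "\<omega> \<in> space M" for n \<omega> z
    using assms(9)[of n] that by (simp add: caratheodory_class_def)
  have b_le: "AE \<omega> in M. b z n \<omega> \<le> 2 * (lam n \<omega> * \<epsilon> n \<omega> z)" if z: "z \<in> Z" for z n
    using ineq[OF z, of n] \<mu>_lam[of n] AE_space
  proof eventually_elim
    case (elim \<omega>)
    then have "max 0 (inner z (vec_cond_exp M (\<X> n) (d n) \<omega>)
        - real_cond_exp M (\<X> n) (\<lambda>\<omega>. \<alpha> n \<omega> * \<eta> n \<omega>) \<omega>) \<le> \<epsilon> n \<omega> z"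
      using \<epsilon>0 by (simp add: d[abs_def])
    from mult_left_mono[OF this \<mu>02(1)[of n \<omega>]] show ?case
      using elim(2) by (simp add: b_def)
  qed
  have conv: "AE \<omega> in M. convergent (\<lambda>n. (norm (x n \<omega> - z))\<^sup>2)" if z: "z \<in> Z" for z
  proof (rule quasi_supermartingale.AE_convergent[OF qs])
    have "AE \<omega> in M. \<forall>n. b z n \<omega> \<le> 2 * (lam n \<omega> * \<epsilon> n \<omega> z)"
      using b_le[OF z] by (simp add: AE_all_countable)
    then show "AE \<omega> in M. summable (\<lambda>n. b z n \<omega>)"
      using assms(16)[OF z]
    proof eventually_elim
      case (elim \<omega>)
      show ?case
        by (rule summable_comparison_test'[OF summable_mult[OF elim(2), of 2]]) (use elim(1) b0 in simp)
    qed
  qed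
  obtain D where D: "countable D" "D \<subseteq> Z" "Z \<subseteq> closure D" using separable by blast
  have "AE \<omega> in M. \<forall>z\<in>D. convergent (\<lambda>n. (norm (x n \<omega> - z))\<^sup>2)"
    using conv D(1,2) by (intro AE_ball_countable[THEN iffD2] ballI) auto
  then have weak: "AE \<omega> in M. \<exists>l\<in>Z. weakly_tendsto (\<lambda>n. x n \<omega>) l"
    using cluster
  proof eventually_elim
    case (elim \<omega>)
    show ?case
    proof (rule opial_weak_convergence[OF \<open>Z \<noteq> {}\<close> _ elim(2)])
      fix z assume "z \<in> Z"
      then have "z \<in> closure D" using D(3) by blast
      then show "convergent (\<lambda>n. (norm (x n \<omega> - z))\<^sup>2)"
        by (rule convergent_norm_diff_closure[of D, rotated]) (use elim(1) in blast)
    qed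
  qed
  obtain z0 where z0: "z0 \<in> Z" using \<open>Z \<noteq> {}\<close> by blast
  \<comment> \<open>The value \<open>z0\<close> on the exceptional null set keeps the limit \<open>Z\<close>-valued everywhere.\<close>
  define x' where "x' \<omega> = (if \<exists>l\<in>Z. weakly_tendsto (\<lambda>n. x n \<omega>) l
      then SOME l. l \<in> Z \<and> weakly_tendsto (\<lambda>n. x n \<omega>) l else z0)" for \<omega>
  have x'_lim: "x' \<omega> \<in> Z \<and> weakly_tendsto (\<lambda>n. x n \<omega>) (x' \<omega>)"
    if "\<exists>l\<in>Z. weakly_tendsto (\<lambda>n. x n \<omega>) l" for \<omega>
    using that someI_ex[of "\<lambda>l. l \<in> Z \<and> weakly_tendsto (\<lambda>n. x n \<omega>) l"] by (auto simp: x'_def)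
  have x'Z: "x' \<omega> \<in> Z" for \<omega>
    using x'_lim[of \<omega>] z0 by (cases "\<exists>l\<in>Z. weakly_tendsto (\<lambda>n. x n \<omega>) l") (auto simp: x'_def)
  have lim: "AE \<omega> in M. weakly_tendsto (\<lambda>n. x n \<omega>) (x' \<omega>)"
    using weak by eventually_elim (use x'_lim in blast)
  have x'M: "x' \<in> borel_measurable M"
  proof (rule borel_measurable_weakly)
    fix y
    have "(\<lambda>\<omega>. lim (\<lambda>n. inner (x n \<omega>) y)) \<in> borel_measurable M" by measurable
    moreover have "AE \<omega> in M. lim (\<lambda>n. inner (x n \<omega>) y) = inner (x' \<omega>) y"
      using lim by eventually_elim (auto simp: weakly_tendsto_def intro: limI)
    ultimately show "(\<lambda>\<omega>. inner (x' \<omega>) y) \<in> borel_measurable M" by (rule measurable_AE_eq) simp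
  qed
  have "x' \<in> Lp_rv M 2 \<and> weakly_tendsto_L2 M x x'"
    if sum: "\<forall>z\<in>Z. summable (\<lambda>n. LINT \<omega>|M. lam n \<omega> * \<epsilon> n \<omega> z)"
  proof -
    interpret qs: quasi_supermartingale M \<X> "\<lambda>n \<omega>. (norm (x n \<omega> - z0))\<^sup>2" "b z0" by (rule qs)
    have \<epsilon>i: "integrable M (\<lambda>\<omega>. \<epsilon> n \<omega> z0)" for n
    proof -
      have \<epsilon>M: "(\<lambda>\<omega>. \<epsilon> n \<omega> z0) \<in> borel_measurable M"
        and fin: "(\<integral>\<^sup>+\<omega>. ennreal (\<epsilon> n \<omega> z0) \<partial>M) < \<infinity>"
        using assms(9)[of n] L2_const[of z0] by (auto simp: caratheodory_class_def)
      have "(\<integral>\<^sup>+\<omega>. ennreal (norm (\<epsilon> n \<omega> z0)) \<partial>M) = (\<integral>\<^sup>+\<omega>. ennreal (\<epsilon> n \<omega> z0) \<partial>M)"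
        by (rule nn_integral_cong) (simp add: \<epsilon>0)
      then show ?thesis using \<epsilon>M fin by (intro integrableI_bounded) auto
    qed
    have lam\<epsilon>i: "integrable M (\<lambda>\<omega>. lam n \<omega> * \<epsilon> n \<omega> z0)" for n
    proof (rule Bochner_Integration.integrable_bound)
      show "integrable M (\<lambda>\<omega>. 2 * \<epsilon> n \<omega> z0)" using \<epsilon>i by simp
      have "lam n \<in> borel_measurable M" by (rule measurable_from_subalg[OF sub lamX])
      then show "(\<lambda>\<omega>. lam n \<omega> * \<epsilon> n \<omega> z0) \<in> borel_measurable M"
        using \<epsilon>i by (intro borel_measurable_times) auto
      show "AE \<omega> in M. norm (lam n \<omega> * \<epsilon> n \<omega> z0) \<le> norm (2 * \<epsilon> n \<omega> z0)"
        using \<mu>_lam[of n]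
      proof eventually_elim
        case (elim \<omega>)
        then have "\<bar>lam n \<omega>\<bar> \<le> 2" using \<mu>02[of n \<omega>] by simp
        then show ?case by (simp add: abs_mult mult_right_mono)
      qed
    qed
    have bi: "(LINT \<omega>|M. b z0 n \<omega>) \<le> 2 * (LINT \<omega>|M. lam n \<omega> * \<epsilon> n \<omega> z0)" for n
      using integral_mono_AE[OF qs.int(2) _ b_le[OF z0]] lam\<epsilon>i by simp
    have bi0: "0 \<le> (LINT \<omega>|M. b z0 n \<omega>)" for n
      by (rule Bochner_Integration.integral_nonneg) (rule b0)
    have sumb: "summable (\<lambda>n. LINT \<omega>|M. b z0 n \<omega>)"
      by (rule summable_comparison_test'[OF summable_mult[OF bspec[OF sum z0], of 2]])
        (use bi bi0 in auto)
    define C where "C = 2 * ((LINT \<omega>|M. (norm (x 0 \<omega> - z0))\<^sup>2) + (\<Sum>n. LINT \<omega>|M. b z0 n \<omega>)) + 2 * (norm z0)\<^sup>2"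
    have C: "(LINT \<omega>|M. (norm (x n \<omega>))\<^sup>2) \<le> C" for n
    proof -
      have "(LINT \<omega>|M. (norm (x n \<omega>))\<^sup>2) \<le> (LINT \<omega>|M. 2 * (norm (x n \<omega> - z0))\<^sup>2 + 2 * (norm z0)\<^sup>2)"
        using qs.int(1)[of n] xL2[of n] norm_add_squared_le[of "x n _ - z0" z0]
        by (intro integral_mono) (auto simp: L2_iff)
      also have "\<dots> = 2 * (LINT \<omega>|M. (norm (x n \<omega> - z0))\<^sup>2) + 2 * (norm z0)\<^sup>2"
        using qs.int(1)[of n] by (simp add: prob_space)
      finally show ?thesis
        using qs.LINT_S_le[of n] sum_le_suminf[OF sumb, of "{..<n}"] bi0 by (simp add: C_def)
    qed
    show ?thesis
      using L2_Fatou[OF xL2 C x'M lim] weakly_tendsto_L2I[OF xL2 C x'M lim] by blast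
  qed
  then show ?thesis using x'M x'Z lim by blast
qed

end
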